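(* Let $\mathbf W$ be a general channel with finite input alphabet $\mathcal X$ and arbitrary output alphabet $\mathcal Y$, let $\mathbf c$ be a general cost function and $\Gamma\in\mathbb R$. Then for all $\varepsilon,\delta,\mu,\lambda\ge0$ with $\varepsilon\le\mu$, $\varepsilon\le\lambda$, $\delta<1-\mu-\lambda$, $$\sup_{\mathbf X\in\mathcal S_\Gamma}\underline I(\mathbf X;\mathbf Y)\le C_s(\varepsilon,\Gamma|\mathbf W)\le D(\mu,\lambda,\Gamma|\mathbf W)\le S(\delta,\Gamma|\mathbf W)\le\sup_{\mathbf X\in\mathcal S_\Gamma}\overline I(\mathbf X;\mathbf Y).$$
   Context: A general channel $\mathbf W=\{W^n\}$ with input alphabet $\mathcal X$ and output alphabet $\mathcal Y$ is a sequence of transition probabilities $W^n(\cdot|\mathbf x)$ on $\mathcal Y^n$, $\mathbf x\in\mathcal X^n$. A general cost function is a sequence of functions $c_n:\mathcal X^n\to\mathbb R$; $\mathcal X^n(\Gamma)=\{\mathbf x:\frac1n c_n(\mathbf x)\le\Gamma\}$. $\mathcal S_\Gamma$ is the set of input processes $\mathbf X=\{X^n\}$ with $\Pr\{X^n\in\mathcal X^n(\Gamma)\}=1$ for all $n$; $\mathbf Y=\{Y^n\}$, $Y^n$ the output of $W^n$ for input $X^n$. For real random variables $Z_n$: $\text{p-}\liminf Z_n=\sup\{\alpha:\lim_n\Pr\{Z_n<\alpha\}=0\}$, $\text{p-}\limsup Z_n=\inf\{\beta:\lim_n\Pr\{Z_n>\beta\}=0\}$. $\underline I(\mathbf X;\mathbf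 Y)$ (resp. $\overline I$) is the p-liminf (resp. p-limsup) of $\frac1n\log\frac{W^n(Y^n|X^n)}{P_{Y^n}(Y^n)}$ (for abstract $\mathcal Y$ the ratio is the Radon–Nikodym derivative $\frac{dP_{X^nY^n}}{d(P_{X^n}\times P_{Y^n})}$). $QW^n(B)=\sum_{\mathbf x}Q(\mathbf x)W^n(B|\mathbf x)$. Transmission codes: an $(n,M_n,\varepsilon_n,\Gamma)$ code is an encoder $\varphi_n:\{1,\dots,M_n\}\to\mathcal X^n$ with $\frac1nc_n(\varphi_n(i))\le\Gamma$ for all $i$, and a decoder $\psi_n:\mathcal Y^n\to\{1,\dots,M_n\}$, with $\varepsilon_n=\frac1{M_n}\sum_iW^n(\mathcal D_i^c|\varphi_n(i))$, $\mathcal D_i=\psi_n^{-1}(i)$. $R$ is $(\varepsilon,\Gamma)$-achievable if such codes exist with $\limsup\varepsilon_n\le\varepsilon$, $\liminf\frac1n\log M_n\ge R$; $C_s(\varepsilon,\Gamma|\mathbf W)$ is the supremum of such $R$. Identification codes: an $(n,N_n,\mu_n,\lambda_n,\Gamma)$ code consists of distributions $Q_1,\dots,Q_{N_n}$ on $\mathcal X^n$ with $Q_i(\mathcal X^n(\Gamma))=1$ and (not necessarily disjoint) sets $\mathcal D_1,\dots,\mathcal D_{N_n}\subset\mathcal Y^n$, with $\mu_n=\max_iQ_iW^n(\mathcal D_i^c)$, $\lambda_n=\max_{i\ne j}Q_jW^n(\mathcal D_i)$. $R$ is $(\mu,\lambda,\Gamma)$-achievable if such codes exist with $\limsup\mu_n\le\mu$,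 $\limsup\lambda_n\le\lambda$, $\liminf\frac1n\log\log N_n\ge R$; $D(\mu,\lambda,\Gamma|\mathbf W)$ is the supremum of such $R$. Resolvability: $d(P,P')=2\sup_B|P(B)-P'(B)|$; $U_M$ uniform on $\{1,\dots,M\}$. For $\mathbf X\in\mathcal S_\Gamma$, $R$ is $(\delta,\Gamma)$-achievable for $\mathbf X$ if there are $M_n$ and maps $\varphi_n:\{1,\dots,M_n\}\to\mathcal X^n(\Gamma)$ such that, with $\tilde Y^n$ the output of $W^n$ for input $\varphi_n(U_{M_n})$, $\limsup d(P_{Y^n},P_{\tilde Y^n})\le\delta$ and $\limsup\frac1n\log M_n\le R$. $R$ is $(\delta,\Gamma)$-achievable if so for all $\mathbf X\in\mathcal S_\Gamma$; $S(\delta,\Gamma|\mathbf W)$ is the infimum of such $R$. *)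

theory Defs
  imports "HOL-Probability.Probability"
begin

definition Yn :: "'b measure \<Rightarrow> nat \<Rightarrow> (nat \<Rightarrow> 'b) measure" where
  "Yn Y n = PiM {..<n} (\<lambda>_. Y)"

definition inputs :: "nat \<Rightarrow> 'a list set" where
  "inputs n = {x. length x = n}"

definition costset :: "(nat \<Rightarrow> 'a list \<Rightarrow> real) \<Rightarrow> real \<Rightarrow> nat \<Rightarrow> 'a list set" where
  "costset c \<Gamma> n = {x. length x = n \<and> c n x / real n \<le> \<Gamma>}"

definition general_channel :: "'b measure \<Rightarrow> (nat \<Rightarrow> 'a list \<Rightarrow> (nat \<Rightarrow> 'b) measure) \<Rightarrow> bool" where
  "general_channel Y W \<longleftrightarrow>
     (\<forall>n x. length x = n \<longrightarrow> prob_space (W n x) \<and> sets (W n x) = sets (Yn Y n))"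

definition outdist :: "'b measure \<Rightarrow> (nat \<Rightarrow> 'a::finite list \<Rightarrow> (nat \<Rightarrow> 'b) measure) \<Rightarrow> nat
    \<Rightarrow> 'a list pmf \<Rightarrow> (nat \<Rightarrow> 'b) measure" where
  "outdist Y W n Q = measure_of (space (Yn Y n)) (sets (Yn Y n))
     (\<lambda>B. \<Sum>x\<in>inputs n. ennreal (pmf Q x) * emeasure (W n x) B)"

definition jointdist :: "'b measure \<Rightarrow> (nat \<Rightarrow> 'a::finite list \<Rightarrow> (nat \<Rightarrow> 'b) measure) \<Rightarrow> nat
    \<Rightarrow> 'a list pmf \<Rightarrow> ('a list \<times> (nat \<Rightarrow> 'b)) measure" where
  "jointdist Y W n Q = measure_of (space (count_space UNIV \<Otimes>\<^sub>M Yn Y n))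
     (sets (count_space UNIV \<Otimes>\<^sub>M Yn Y n))
     (\<lambda>A. \<Sum>x\<in>inputs n. ennreal (pmf Q x) * emeasure (W n x) (Pair x -` A \<inter> space (Yn Y n)))"

definition info_dens :: "'b measure \<Rightarrow> (nat \<Rightarrow> 'a::finite list \<Rightarrow> (nat \<Rightarrow> 'b) measure) \<Rightarrow> nat
    \<Rightarrow> 'a list pmf \<Rightarrow> 'a list \<times> (nat \<Rightarrow> 'b) \<Rightarrow> real" where
  "info_dens Y W n Q = (\<lambda>z. ln (enn2real (RN_deriv (measure_pmf Q \<Otimes>\<^sub>M outdist Y W n Q)
        (jointdist Y W n Q) z)) / real n)"

definition p_liminf :: "(nat \<Rightarrow> 'z measure) \<Rightarrow> (nat \<Rightarrow> 'z \<Rightarrow> real) \<Rightarrow> ereal" where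
  "p_liminf P Z = Sup {ereal \<alpha> | \<alpha>. (\<lambda>n. measure (P n) {z \<in> space (P n). Z n z < \<alpha>}) \<longlonglongrightarrow> 0}"

definition p_limsup :: "(nat \<Rightarrow> 'z measure) \<Rightarrow> (nat \<Rightarrow> 'z \<Rightarrow> real) \<Rightarrow> ereal" where
  "p_limsup P Z = Inf {ereal \<beta> | \<beta>. (\<lambda>n. measure (P n) {z \<in> space (P n). Z n z > \<beta>}) \<longlonglongrightarrow> 0}"

definition I_lower :: "'b measure \<Rightarrow> (nat \<Rightarrow> 'a::finite list \<Rightarrow> (nat \<Rightarrow> 'b) measure)
    \<Rightarrow> (nat \<Rightarrow> 'a list pmf) \<Rightarrow> ereal" where
  "I_lower Y W PX = p_liminf (\<lambda>n. jointdist Y W n (PX n)) (\<lambda>n. info_dens Y W n (PX n))"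

definition I_upper :: "'b measure \<Rightarrow> (nat \<Rightarrow> 'a::finite list \<Rightarrow> (nat \<Rightarrow> 'b) measure)
    \<Rightarrow> (nat \<Rightarrow> 'a list pmf) \<Rightarrow> ereal" where
  "I_upper Y W PX = p_limsup (\<lambda>n. jointdist Y W n (PX n)) (\<lambda>n. info_dens Y W n (PX n))"

text \<open>S_Gamma: input processes (X^n given by its distribution PX n) satisfying the cost
  constraint almost surely for every block length n >= 1.\<close>
definition S_Gamma :: "(nat \<Rightarrow> 'a list \<Rightarrow> real) \<Rightarrow> real \<Rightarrow> (nat \<Rightarrow> 'a list pmf) set" where
  "S_Gamma c \<Gamma> = {PX. \<forall>n\<ge>1. set_pmf (PX n) \<subseteq> costset c \<Gamma> n}"

definition trans_err :: "'b measure \<Rightarrow> (nat \<Rightarrow> 'a list \<Rightarrow> (nat \<Rightarrow> 'b) measure) \<Rightarrow> nat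
    \<Rightarrow> nat \<Rightarrow> (nat \<Rightarrow> 'a list) \<Rightarrow> ((nat \<Rightarrow> 'b) \<Rightarrow> nat) \<Rightarrow> real" where
  "trans_err Y W n M \<phi> \<psi> =
     (\<Sum>i\<in>{1..M}. measure (W n (\<phi> i)) (space (Yn Y n) - \<psi> -` {i})) / real M"

definition trans_achievable :: "'b measure \<Rightarrow> (nat \<Rightarrow> 'a list \<Rightarrow> (nat \<Rightarrow> 'b) measure)
    \<Rightarrow> (nat \<Rightarrow> 'a list \<Rightarrow> real) \<Rightarrow> real \<Rightarrow> real \<Rightarrow> real \<Rightarrow> bool" where
  "trans_achievable Y W c \<Gamma> \<epsilon> R \<longleftrightarrow>
     (\<exists>(M :: nat \<Rightarrow> nat) \<phi> \<psi>.
        (\<forall>n\<ge>1. M n \<ge> 1 \<and> (\<forall>i\<in>{1..M n}. \<phi> n i \<in> costset c \<Gamma> n)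
           \<and> \<psi> n \<in> space (Yn Y n) \<rightarrow> {1..M n}
           \<and> (\<forall>i\<in>{1..M n}. \<psi> n -` {i} \<inter> space (Yn Y n) \<in> sets (Yn Y n)))
      \<and> limsup (\<lambda>n. ereal (trans_err Y W n (M n) (\<phi> n) (\<psi> n))) \<le> ereal \<epsilon>
      \<and> liminf (\<lambda>n. ereal (ln (real (M n)) / real n)) \<ge> ereal R)"

definition C_s :: "'b measure \<Rightarrow> (nat \<Rightarrow> 'a list \<Rightarrow> (nat \<Rightarrow> 'b) measure)
    \<Rightarrow> (nat \<Rightarrow> 'a list \<Rightarrow> real) \<Rightarrow> real \<Rightarrow> real \<Rightarrow> ereal" where
  "C_s Y W c \<Gamma> \<epsilon> = Sup (ereal ` {R. trans_achievable Y W c \<Gamma> \<epsilon> R})"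

text \<open>Identification codes: mu_n = max_i Q_i W^n(D_i^c),
  lambda_n = max_{i <> j} Q_j W^n(D_i) (taken as 0 if N_n = 1).\<close>
definition id_mu :: "'b measure \<Rightarrow> (nat \<Rightarrow> 'a::finite list \<Rightarrow> (nat \<Rightarrow> 'b) measure) \<Rightarrow> nat
    \<Rightarrow> nat \<Rightarrow> (nat \<Rightarrow> 'a list pmf) \<Rightarrow> (nat \<Rightarrow> (nat \<Rightarrow> 'b) set) \<Rightarrow> real" where
  "id_mu Y W n N Q D =
     Max ((\<lambda>i. measure (outdist Y W n (Q i)) (space (Yn Y n) - D i)) ` {1..N})"

definition id_lambda :: "'b measure \<Rightarrow> (nat \<Rightarrow> 'a::finite list \<Rightarrow> (nat \<Rightarrow> 'b) measure) \<Rightarrow> nat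
    \<Rightarrow> nat \<Rightarrow> (nat \<Rightarrow> 'a list pmf) \<Rightarrow> (nat \<Rightarrow> (nat \<Rightarrow> 'b) set) \<Rightarrow> real" where
  "id_lambda Y W n N Q D =
     Max (insert 0 {measure (outdist Y W n (Q j)) (D i) | i j. i \<in> {1..N} \<and> j \<in> {1..N} \<and> i \<noteq> j})"

definition ident_achievable :: "'b measure \<Rightarrow> (nat \<Rightarrow> 'a::finite list \<Rightarrow> (nat \<Rightarrow> 'b) measure)
    \<Rightarrow> (nat \<Rightarrow> 'a list \<Rightarrow> real) \<Rightarrow> real \<Rightarrow> real \<Rightarrow> real \<Rightarrow> real \<Rightarrow> bool" where
  "ident_achievable Y W c \<Gamma> \<mu> lam R \<longleftrightarrow>
     (\<exists>(N :: nat \<Rightarrow> nat) Q D.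
        (\<forall>n\<ge>1. N n \<ge> 1 \<and> (\<forall>i\<in>{1..N n}. set_pmf (Q n i) \<subseteq> costset c \<Gamma> n
                                 \<and> D n i \<in> sets (Yn Y n)))
      \<and> limsup (\<lambda>n. ereal (id_mu Y W n (N n) (Q n) (D n))) \<le> ereal \<mu>
      \<and> limsup (\<lambda>n. ereal (id_lambda Y W n (N n) (Q n) (D n))) \<le> ereal lam
      \<and> liminf (\<lambda>n. ereal (ln (ln (real (N n))) / real n)) \<ge> ereal R)"

definition D_id :: "'b measure \<Rightarrow> (nat \<Rightarrow> 'a::finite list \<Rightarrow> (nat \<Rightarrow> 'b) measure)
    \<Rightarrow> (nat \<Rightarrow> 'a list \<Rightarrow> real) \<Rightarrow> real \<Rightarrow> real \<Rightarrow> real \<Rightarrow> ereal" where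
  "D_id Y W c \<Gamma> \<mu> lam = Sup (ereal ` {R. ident_achievable Y W c \<Gamma> \<mu> lam R})"

definition var_dist :: "'c measure \<Rightarrow> 'c measure \<Rightarrow> real" where
  "var_dist P P' = 2 * (SUP B\<in>sets P. \<bar>measure P B - measure P' B\<bar>)"

definition resolv_achievable_for :: "'b measure \<Rightarrow> (nat \<Rightarrow> 'a::finite list \<Rightarrow> (nat \<Rightarrow> 'b) measure)
    \<Rightarrow> (nat \<Rightarrow> 'a list \<Rightarrow> real) \<Rightarrow> real \<Rightarrow> real \<Rightarrow> real \<Rightarrow> (nat \<Rightarrow> 'a list pmf) \<Rightarrow> bool" where
  "resolv_achievable_for Y W c \<Gamma> \<delta> R PX \<longleftrightarrow>
     (\<exists>(M :: nat \<Rightarrow> nat) \<phi>.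
        (\<forall>n\<ge>1. M n \<ge> 1 \<and> (\<forall>i\<in>{1..M n}. \<phi> n i \<in> costset c \<Gamma> n))
      \<and> limsup (\<lambda>n. ereal (var_dist (outdist Y W n (PX n))
            (outdist Y W n (map_pmf (\<phi> n) (pmf_of_set {1..M n}))))) \<le> ereal \<delta>
      \<and> limsup (\<lambda>n. ereal (ln (real (M n)) / real n)) \<le> ereal R)"

definition resolv_achievable :: "'b measure \<Rightarrow> (nat \<Rightarrow> 'a::finite list \<Rightarrow> (nat \<Rightarrow> 'b) measure)
    \<Rightarrow> (nat \<Rightarrow> 'a list \<Rightarrow> real) \<Rightarrow> real \<Rightarrow> real \<Rightarrow> real \<Rightarrow> bool" where
  "resolv_achievable Y W c \<Gamma> \<delta> R \<longleftrightarrow>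
     (\<forall>PX \<in> S_Gamma c \<Gamma>. resolv_achievable_for Y W c \<Gamma> \<delta> R PX)"

definition S_res :: "'b measure \<Rightarrow> (nat \<Rightarrow> 'a::finite list \<Rightarrow> (nat \<Rightarrow> 'b) measure)
    \<Rightarrow> (nat \<Rightarrow> 'a list \<Rightarrow> real) \<Rightarrow> real \<Rightarrow> real \<Rightarrow> ereal" where
  "S_res Y W c \<Gamma> \<delta> = Inf (ereal ` {R. resolv_achievable Y W c \<Gamma> \<delta> R})"

end

(*
  The first inequality is Feinstein's maximal code argument at the threshold exp (n alpha) for the
  density of W^n(.|x) with respect to the output distribution.

  For the second, a transmission code is expurgated so that its maximal error is at most (1 + 1/n)
  times its average error. The remaining codewords are arranged as an s times 4^m array, m of order
  sqrt n; a word f of a Gilbert-Varshamov code of length s over 4^m symbols selects the entries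
  (i, f i), and the uniform distribution on them, with the union of their decoding sets, is an
  identification message. There are 2^s of these, and any two share less than a fraction 1/m of
  their codewords.

  For the third, if every message distribution of an identification code could be approximated by
  uniform distributions on at most exp (n r) points, then counting the lists of points would bound
  the number of messages doubly exponentially with rate r. Otherwise, picking for each n a message
  distribution that cannot be approximated gives an input process violating resolvability at rates
  below r.

  The last is soft covering: for random codewords the truncated densities have small variance. The
  codewords are chosen successively so as not to exceed the average growth of a second moment.
*)
theory Submission
  imports Defs "HOL-Real_Asymp.Real_Asymp"
begin

section \<open>Output and joint distributions of a channel\<close>

text \<open>As the outputs are abstract, the estimates go through one object, the density of
  W^n(.|x) with respect to the output law. It is available at words x of positive probability, so
  the codewords constructed from an input distribution are taken from its support, where the cost
  constraint holds too. No space of random codebooks is built: a point that is no worse than the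
  average replaces the random choice. Expurgation uses the factor 1 + 1/n because a constant such as
  2 would spoil the asymptotic error. In the array, 4^m letters make a ball of words with many
  agreements a fraction of at most 2^-s of all words, while m of order sqrt n lets 1/m vanish and
  keeps 4^m subexponential. A resolvability code may depend on the whole process, so there is no
  uniformity over the inputs at one block length; this forces the diagonal choice of a process.
  Densities may lack a second moment, hence the truncation. The convention \<open>ln 0 = 0\<close>
  inside \<open>info_dens\<close> is harmless only at suitable thresholds. Rates at most 0 are
  therefore served by one-message codes, and negative spectral sup-information rates are
  excluded.\<close>

lemma finite_inputs [simp]: "finite (inputs n :: 'a::finite list set)"
  unfolding inputs_def using finite_lists_length_eq[of "UNIV :: 'a set" n] by simp

lemma card_inputs: "card (inputs n :: 'a::finite list set) = CARD('a) ^ n"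
  unfolding inputs_def using card_lists_length_eq[of "UNIV :: 'a set" n] by simp

lemma costset_subset_inputs: "costset c \<Gamma> n \<subseteq> inputs n"
  by (auto simp: costset_def inputs_def)

lemma sum_pmf_inputs:
  assumes "set_pmf Q \<subseteq> inputs n"
  shows "(\<Sum>x\<in>inputs n. pmf Q (x :: 'a::finite list)) = 1"
  using assms by (intro sum_pmf_eq_1) auto

text \<open>This is the whole probabilistic method of the development: Feinstein's argument and soft
  covering both pick the next codeword by it. The point has to lie in the support, where the cost
  constraint and \<open>density_W\<close> are available.\<close>

lemma exists_le_average:
  assumes supp: "set_pmf Q \<subseteq> inputs n"
  shows "\<exists>x\<in>set_pmf Q. F x \<le> (\<Sum>x\<in>inputs n. pmf Q (x :: 'a::finite list) * F x)" (is "\<exists>x\<in>_. F x \<le> ?m")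
proof (rule ccontr)
  assume "\<not> ?thesis"
  then have gt: "?m < F x" if "x \<in> set_pmf Q" for x
    using that by auto
  obtain x0 where x0: "x0 \<in> set_pmf Q" using set_pmf_not_empty by fastforce
  have "?m = (\<Sum>x\<in>inputs n. pmf Q x * ?m)"
    using sum_pmf_inputs[OF supp] by (simp flip: sum_distrib_right)
  also have "\<dots> < ?m"
  proof (rule sum_strict_mono_ex1)
    show "\<forall>x\<in>inputs n. pmf Q x * ?m \<le> pmf Q x * F x"
    proof
      fix x
      show "pmf Q x * ?m \<le> pmf Q x * F x"
      proof (cases "x \<in> set_pmf Q")
        case True
        then show ?thesis using gt[OF True] by (intro mult_left_mono) auto
      qed (simp add: set_pmf_iff)
    qed
    show "\<exists>x\<in>inputs n. pmf Q x * ?m < pmf Q x * F x"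
      using x0 supp gt pmf_positive[OF x0] by (intro bexI[of _ x0] mult_strict_left_mono) auto
  qed simp
  finally show False by simp
qed

locale finite_channel =
  fixes Y :: "'b measure" and W :: "nat \<Rightarrow> 'a::finite list \<Rightarrow> (nat \<Rightarrow> 'b) measure" and n :: nat
  assumes channel: "general_channel Y W"
begin

lemma prob_space_W: "x \<in> inputs n \<Longrightarrow> prob_space (W n x)"
  and sets_W: "x \<in> inputs n \<Longrightarrow> sets (W n x) = sets (Yn Y n)"
  using channel by (auto simp: general_channel_def inputs_def)

lemma space_W: "x \<in> inputs n \<Longrightarrow> space (W n x) = space (Yn Y n)"
  using sets_W sets_eq_imp_space_eq by blast

lemma sets_outdist [simp, measurable_cong]: "sets (outdist Y W n Q) = sets (Yn Y n)"
  and space_outdist [simp]: "space (outdist Y W n Q) = space (Yn Y n)"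
  by (simp_all add: outdist_def space_measure_of_conv)

lemma sets_jointdist [simp, measurable_cong]:
  "sets (jointdist Y W n Q) = sets (count_space UNIV \<Otimes>\<^sub>M Yn Y n)"
  and space_jointdist [simp]: "space (jointdist Y W n Q) = UNIV \<times> space (Yn Y n)"
  unfolding jointdist_def sets.sets_measure_of_eq sets.space_measure_of_eq by (simp_all add: space_pair_measure)

lemma emeasure_outdist:
  assumes "B \<in> sets (Yn Y n)"
  shows "emeasure (outdist Y W n Q) B = (\<Sum>x\<in>inputs n. ennreal (pmf Q x) * emeasure (W n x) B)"
  unfolding outdist_def
proof (rule emeasure_measure_of_sigma[OF _ _ _ assms])
  show "sigma_algebra (space (Yn Y n)) (sets (Yn Y n))"
    by (rule sets.sigma_algebra_axioms)
  show "positive (sets (Yn Y n)) (\<lambda>B. \<Sum>x\<in>inputs n. ennreal (pmf Q x) * emeasure (W n x) B)"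
    by (simp add: positive_def)
  show "countably_additive (sets (Yn Y n)) (\<lambda>B. \<Sum>x\<in>inputs n. ennreal (pmf Q x) * emeasure (W n x) B)"
  proof (rule countably_additiveI)
    fix A :: "nat \<Rightarrow> _" assume A: "range A \<subseteq> sets (Yn Y n)" "disjoint_family A"
    have "(\<Sum>i. \<Sum>x\<in>inputs n. ennreal (pmf Q x) * emeasure (W n x) (A i)) =
      (\<Sum>x\<in>inputs n. \<Sum>i. ennreal (pmf Q x) * emeasure (W n x) (A i))"
      by (rule suminf_sum) auto
    also have "\<dots> = (\<Sum>x\<in>inputs n. ennreal (pmf Q x) * emeasure (W n x) (\<Union> (range A)))"
      using A by (intro sum.cong refl) (simp add: suminf_emeasure sets_W)
    finally show "(\<Sum>i. \<Sum>x\<in>inputs n. ennreal (pmf Q x) * emeasure (W n x) (A i)) =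
      (\<Sum>x\<in>inputs n. ennreal (pmf Q x) * emeasure (W n x) (\<Union> (range A)))" .
  qed
qed

lemma emeasure_jointdist:
  assumes "A \<in> sets (count_space UNIV \<Otimes>\<^sub>M Yn Y n)"
  shows "emeasure (jointdist Y W n Q) A =
    (\<Sum>x\<in>inputs n. ennreal (pmf Q x) * emeasure (W n x) (Pair x -` A \<inter> space (Yn Y n)))"
    (is "_ = ?\<mu> A")
  unfolding jointdist_def
proof (rule emeasure_measure_of_sigma[OF _ _ _ assms])
  let ?P = "count_space UNIV \<Otimes>\<^sub>M Yn Y n"
  show "sigma_algebra (space ?P) (sets ?P)"
    by (rule sets.sigma_algebra_axioms)
  show "positive (sets ?P) ?\<mu>"
    by (simp add: positive_def)
  show "countably_additive (sets ?P) ?\<mu>"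
  proof (rule countably_additiveI)
    fix A :: "nat \<Rightarrow> ('a list \<times> (nat \<Rightarrow> 'b)) set" assume A: "range A \<subseteq> sets ?P" "disjoint_family A"
    have [simp]: "Pair x -` A i \<inter> space (Yn Y n) \<in> sets (Yn Y n)" for x i
      using A sets_Pair1[of "A i" "count_space UNIV" "Yn Y n" x] sets.sets_into_space
      by (metis sets.Int_space_eq2 range_subsetD)
    have "(\<Sum>i. ?\<mu> (A i)) =
      (\<Sum>x\<in>inputs n. \<Sum>i. ennreal (pmf Q x) * emeasure (W n x) (Pair x -` A i \<inter> space (Yn Y n)))"
      by (rule suminf_sum) auto
    also have "\<dots> = ?\<mu> (\<Union> (range A))"
    proof (intro sum.cong refl)
      fix x :: "'a list" assume x: "x \<in> inputs n"
      have "disjoint_family (\<lambda>i. Pair x -` A i \<inter> space (Yn Y n))"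
        using A(2) by (auto simp: disjoint_family_on_def)
      moreover have "Pair x -` \<Union> (range A) \<inter> space (Yn Y n) = (\<Union>i. Pair x -` A i \<inter> space (Yn Y n))"
        by auto
      ultimately show "(\<Sum>i. ennreal (pmf Q x) * emeasure (W n x) (Pair x -` A i \<inter> space (Yn Y n))) =
        ennreal (pmf Q x) * emeasure (W n x) (Pair x -` \<Union> (range A) \<inter> space (Yn Y n))"
        using x by (simp add: suminf_emeasure sets_W image_subset_iff)
    qed
    finally show "(\<Sum>i. ?\<mu> (A i)) = ?\<mu> (\<Union> (range A))" .
  qed
qed

section \<open>Laws induced by an input of block length n, and the density of the channel\<close>

context
  fixes Q :: "'a list pmf"
  assumes supp: "set_pmf Q \<subseteq> inputs n"
begin

lemma prob_space_outdist: "prob_space (outdist Y W n Q)"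
proof
  have "emeasure (W n x) (space (Yn Y n)) = 1" if "x \<in> inputs n" for x
    using prob_space.emeasure_space_1[OF prob_space_W[OF that]] space_W[OF that] by simp
  then have "emeasure (outdist Y W n Q) (space (Yn Y n)) = (\<Sum>x\<in>inputs n. ennreal (pmf Q x))"
    by (simp add: emeasure_outdist)
  also have "\<dots> = 1"
    using sum_pmf_inputs[OF supp] by (simp add: sum_ennreal)
  finally show "emeasure (outdist Y W n Q) (space (outdist Y W n Q)) = 1" by simp
qed

lemma measure_outdist:
  assumes "B \<in> sets (Yn Y n)"
  shows "measure (outdist Y W n Q) B = (\<Sum>x\<in>inputs n. pmf Q x * measure (W n x) B)"
proof -
  have "emeasure (outdist Y W n Q) B = (\<Sum>x\<in>inputs n. ennreal (pmf Q x * measure (W n x) B))"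
    unfolding emeasure_outdist[OF assms]
  proof (intro sum.cong refl)
    fix x :: "'a list" assume "x \<in> inputs n"
    then interpret prob_space "W n x" by (rule prob_space_W)
    show "ennreal (pmf Q x) * emeasure (W n x) B = ennreal (pmf Q x * measure (W n x) B)"
      by (simp add: emeasure_eq_measure ennreal_mult)
  qed
  also have "\<dots> = ennreal (\<Sum>x\<in>inputs n. pmf Q x * measure (W n x) B)"
    by (intro sum_ennreal) simp
  finally show ?thesis
    by (simp add: measure_def sum_nonneg)
qed

lemma measure_jointdist:
  assumes "A \<in> sets (count_space UNIV \<Otimes>\<^sub>M Yn Y n)"
  shows "measure (jointdist Y W n Q) A =
    (\<Sum>x\<in>inputs n. pmf Q x * measure (W n x) (Pair x -` A \<inter> space (Yn Y n)))"
proof -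
  have "emeasure (jointdist Y W n Q) A =
      (\<Sum>x\<in>inputs n. ennreal (pmf Q x * measure (W n x) (Pair x -` A \<inter> space (Yn Y n))))"
    unfolding emeasure_jointdist[OF assms]
  proof (intro sum.cong refl)
    fix x :: "'a list" assume "x \<in> inputs n"
    then interpret prob_space "W n x" by (rule prob_space_W)
    show "ennreal (pmf Q x) * emeasure (W n x) (Pair x -` A \<inter> space (Yn Y n)) =
        ennreal (pmf Q x * measure (W n x) (Pair x -` A \<inter> space (Yn Y n)))"
      by (simp add: emeasure_eq_measure ennreal_mult)
  qed
  also have "\<dots> = ennreal (\<Sum>x\<in>inputs n. pmf Q x * measure (W n x) (Pair x -` A \<inter> space (Yn Y n)))"
    by (intro sum_ennreal) simp
  finally show ?thesis
    by (simp add: measure_def sum_nonneg)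
qed

lemma emeasure_pmf_pair_outdist:
  assumes "A \<in> sets (count_space UNIV \<Otimes>\<^sub>M Yn Y n)"
  shows "emeasure (measure_pmf Q \<Otimes>\<^sub>M outdist Y W n Q) A =
    (\<Sum>x\<in>inputs n. ennreal (pmf Q x) * emeasure (outdist Y W n Q) (Pair x -` A))"
proof -
  interpret O: prob_space "outdist Y W n Q" by (rule prob_space_outdist)
  have "sets (measure_pmf Q \<Otimes>\<^sub>M outdist Y W n Q) = sets (count_space UNIV \<Otimes>\<^sub>M Yn Y n)"
    by (intro sets_pair_measure_cong) auto
  then have "emeasure (measure_pmf Q \<Otimes>\<^sub>M outdist Y W n Q) A =
      (\<integral>\<^sup>+x. emeasure (outdist Y W n Q) (Pair x -` A) \<partial>measure_pmf Q)"
    using assms by (intro O.emeasure_pair_measure_alt) simp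
  also have "\<dots> = (\<Sum>x\<in>inputs n. emeasure (outdist Y W n Q) (Pair x -` A) * ennreal (pmf Q x))"
    using supp by (intro nn_integral_measure_pmf_support) (auto simp: set_pmf_iff)
  finally show ?thesis by (simp add: mult.commute)
qed

text \<open>The information density before logarithm and normalisation. Estimates are made with
  \<open>dens\<close>, on which the convention \<open>ln 0 = 0\<close> has no effect.
  \<open>enn2real\<close> turns an infinite derivative into 0; at words of the support this happens
  on a null set only (see \<open>density_W\<close>).\<close>

definition dens :: "'a list \<Rightarrow> (nat \<Rightarrow> 'b) \<Rightarrow> real" where
  "dens x y = enn2real (RN_deriv (measure_pmf Q \<Otimes>\<^sub>M outdist Y W n Q) (jointdist Y W n Q) (x, y))"

lemma dens_nonneg: "0 \<le> dens x y"
  by (simp add: dens_def)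

lemma info_dens_eq: "info_dens Y W n Q (x, y) = ln (dens x y) / real n"
  by (simp add: info_dens_def dens_def)

lemma sets_prod: "sets (measure_pmf Q \<Otimes>\<^sub>M outdist Y W n Q) = sets (count_space UNIV \<Otimes>\<^sub>M Yn Y n)"
  by (intro sets_pair_measure_cong) auto

lemma RN_measurable [measurable]:
  "RN_deriv (measure_pmf Q \<Otimes>\<^sub>M outdist Y W n Q) (jointdist Y W n Q) \<in>
    borel_measurable (count_space UNIV \<Otimes>\<^sub>M Yn Y n)"
  using borel_measurable_RN_deriv[of "measure_pmf Q \<Otimes>\<^sub>M outdist Y W n Q" "jointdist Y W n Q"]
  unfolding measurable_cong_sets[OF sets_prod refl] .

lemma info_dens_measurable [measurable]:
  "info_dens Y W n Q \<in> borel_measurable (count_space UNIV \<Otimes>\<^sub>M Yn Y n)"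
  unfolding info_dens_def by measurable

lemma dens_measurable [measurable]: "dens x \<in> borel_measurable (Yn Y n)"
  unfolding dens_def by measurable

text \<open>The output law is at least \<open>pmf Q x\<close> times \<open>W n x\<close>, and this
  factor is positive on the support.\<close>

lemma W_abs_continuous:
  assumes "x \<in> set_pmf Q" "B \<in> sets (Yn Y n)" "emeasure (outdist Y W n Q) B = 0"
  shows "emeasure (W n x) B = 0"
proof -
  have "(\<Sum>z\<in>inputs n. ennreal (pmf Q z) * emeasure (W n z) B) = 0"
    using assms(3) emeasure_outdist[OF assms(2)] by simp
  then have "ennreal (pmf Q x) * emeasure (W n x) B = 0"
    using assms(1) supp by (subst (asm) sum_eq_0_iff) auto
  moreover have "ennreal (pmf Q x) \<noteq> 0"
    using pmf_positive[OF assms(1)] by simp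
  ultimately show ?thesis by simp
qed

text \<open>The derivative of the joint law is read off on rectangles {x} x B, where both sides
  carry the positive factor \<open>pmf Q x\<close>, which cancels. Afterwards one can work at a
  fixed input word and forget the product measure.\<close>

lemma density_W:
  assumes x: "x \<in> set_pmf Q"
  shows "W n x = density (outdist Y W n Q) (\<lambda>y. ennreal (dens x y))"
proof -
  let ?O = "outdist Y W n Q" and ?J = "jointdist Y W n Q"
  let ?P = "measure_pmf Q \<Otimes>\<^sub>M ?O"
  let ?R = "RN_deriv ?P ?J"
  interpret O: prob_space ?O by (rule prob_space_outdist)
  interpret pair_prob_space "measure_pmf Q" ?O ..
  have xi: "x \<in> inputs n" using x supp by auto
  \<comment> \<open>A null set of the product has null sections at all words of positive
    probability, and there the output law dominates the channel; the other words have weight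
    0.\<close>
  have ac: "absolutely_continuous ?P ?J"
    unfolding absolutely_continuous_def
  proof
    fix A assume "A \<in> null_sets ?P"
    then have A: "A \<in> sets (count_space UNIV \<Otimes>\<^sub>M Yn Y n)" and 0: "emeasure ?P A = 0"
      by (auto simp: null_sets_def sets_prod)
    have sec: "Pair z -` A \<in> sets (Yn Y n)" for z
      using A by (rule sets_Pair1)
    then have "Pair z -` A \<inter> space (Yn Y n) = Pair z -` A" for z
      using sets.sets_into_space by blast
    moreover have "ennreal (pmf Q z) * emeasure (W n z) (Pair z -` A) = 0" if z: "z \<in> inputs n" for z
    proof (cases "z \<in> set_pmf Q")
      case True
      have "ennreal (pmf Q z) * emeasure ?O (Pair z -` A) = 0"
        using 0 z unfolding emeasure_pmf_pair_outdist[OF A] by (subst (asm) sum_eq_0_iff) auto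
      then have "emeasure ?O (Pair z -` A) = 0"
        using pmf_positive[OF True] by simp
      then show ?thesis
        using W_abs_continuous[OF True sec] by simp
    qed (simp add: set_pmf_iff)
    ultimately have "emeasure ?J A = 0"
      by (simp add: emeasure_jointdist[OF A])
    with A show "A \<in> null_sets ?J" by (simp add: null_sets_def)
  qed
  have J: "density ?P ?R = ?J"
    by (rule density_RN_deriv[OF ac]) (simp add: sets_prod)
  have slice: "emeasure (W n x) B = (\<integral>\<^sup>+y. ?R (x, y) * indicator B y \<partial>?O)"
    if B: "B \<in> sets (Yn Y n)" for B
  proof -
    have A: "{x} \<times> B \<in> sets (count_space UNIV \<Otimes>\<^sub>M Yn Y n)"
      using B by auto
    have pxB: "Pair z -` ({x} \<times> B) \<inter> space (Yn Y n) = (if z = x then B else {})" for z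
      using B sets.sets_into_space by auto
    have "emeasure ?J ({x} \<times> B) = (\<Sum>z\<in>inputs n. if z = x then ennreal (pmf Q x) * emeasure (W n x) B else 0)"
      unfolding emeasure_jointdist[OF A] pxB by (intro sum.cong) auto
    also have "\<dots> = ennreal (pmf Q x) * emeasure (W n x) B"
      using xi by (simp add: sum.delta)
    finally have 1: "emeasure ?J ({x} \<times> B) = ennreal (pmf Q x) * emeasure (W n x) B" .
    have "emeasure ?J ({x} \<times> B) = (\<integral>\<^sup>+z. ?R z * indicator ({x} \<times> B) z \<partial>?P)"
      using A by (subst J[symmetric], intro emeasure_density) (auto simp: sets_prod)
    also have "\<dots> = (\<integral>\<^sup>+z. (\<integral>\<^sup>+y. ?R (z, y) * indicator ({x} \<times> B) (z, y) \<partial>?O) \<partial>measure_pmf Q)"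
      using A by (subst O.nn_integral_fst[symmetric]) (auto simp: sets_prod intro!: borel_measurable_times borel_measurable_indicator)
    also have "\<dots> = (\<Sum>z\<in>inputs n. (\<integral>\<^sup>+y. ?R (z, y) * indicator ({x} \<times> B) (z, y) \<partial>?O) * ennreal (pmf Q z))"
      using supp by (intro nn_integral_measure_pmf_support) (auto simp: set_pmf_iff)
    also have "\<dots> = (\<Sum>z\<in>inputs n. if z = x then (\<integral>\<^sup>+y. ?R (x, y) * indicator B y \<partial>?O) * ennreal (pmf Q x) else 0)"
      by (intro sum.cong refl) (auto simp: indicator_times)
    also have "\<dots> = (\<integral>\<^sup>+y. ?R (x, y) * indicator B y \<partial>?O) * ennreal (pmf Q x)"
      using xi by (simp add: sum.delta)
    finally have "ennreal (pmf Q x) * emeasure (W n x) B =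
        ennreal (pmf Q x) * (\<integral>\<^sup>+y. ?R (x, y) * indicator B y \<partial>?O)"
      using 1 by (simp add: mult.commute)
    moreover have "ennreal (pmf Q x) \<noteq> 0"
      using pmf_positive[OF x] by simp
    ultimately show ?thesis
      using ennreal_mult_cancel_left[of "ennreal (pmf Q x)"] by simp
  qed
  have Rm: "(\<lambda>y. ?R (x, y)) \<in> borel_measurable ?O"
    by measurable
  \<comment> \<open>The derivative has integral 1 along the slice, hence is finite almost
    everywhere, and passing to the real-valued \<open>dens\<close> loses nothing.\<close>
  have "emeasure (W n x) (space (Yn Y n)) = 1"
    using prob_space.emeasure_space_1[OF prob_space_W[OF xi]] space_W[OF xi] by simp
  moreover have "(\<integral>\<^sup>+y. ?R (x, y) * indicator (space (Yn Y n)) y \<partial>?O) = (\<integral>\<^sup>+y. ?R (x, y) \<partial>?O)"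
    by (intro nn_integral_cong) auto
  ultimately have "(\<integral>\<^sup>+y. ?R (x, y) \<partial>?O) = 1"
    using slice[of "space (Yn Y n)"] by auto
  then have fin: "AE y in ?O. ?R (x, y) \<noteq> \<infinity>"
    by (intro nn_integral_PInf_AE[OF Rm]) auto
  have "W n x = density ?O (\<lambda>y. ?R (x, y))"
    using xi Rm by (intro measure_eqI) (auto simp: sets_W emeasure_density slice)
  also have "\<dots> = density ?O (\<lambda>y. ennreal (dens x y))"
    using fin by (intro density_cong Rm) (auto simp: dens_def less_top elim!: eventually_mono)
  finally show ?thesis .
qed

end

text \<open>\<open>\<phi>\<close> need not be injective; integrating over the image distribution
  counts repeated codewords with their multiplicity.\<close>

lemma measure_outdist_uniform:
  assumes A: "finite A" "A \<noteq> {}" and \<phi>: "\<phi> ` A \<subseteq> inputs n" and B: "B \<in> sets (Yn Y n)"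
  shows "measure (outdist Y W n (map_pmf \<phi> (pmf_of_set A))) B = (\<Sum>i\<in>A. measure (W n (\<phi> i)) B) / card A"
proof -
  let ?Q = "map_pmf \<phi> (pmf_of_set A)"
  have "set_pmf ?Q \<subseteq> inputs n" using A \<phi> by simp
  then have "measure (outdist Y W n ?Q) B = (\<Sum>x\<in>inputs n. measure (W n x) B * pmf ?Q x)"
    using B by (simp add: measure_outdist mult.commute)
  also have "\<dots> = (\<integral>x. measure (W n x) B \<partial>measure_pmf ?Q)"
    using \<open>set_pmf ?Q \<subseteq> inputs n\<close> by (intro integral_measure_pmf_real[symmetric]) auto
  also have "\<dots> = (\<Sum>i\<in>A. measure (W n (\<phi> i)) B) / card A"
    using A by (simp add: integral_pmf_of_set)
  finally show ?thesis .
qed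

end

section \<open>Feinstein codes\<close>

lemma limsup_le_lim:
  assumes "\<forall>\<^sub>F n in sequentially. f n \<le> g n" "g \<longlonglongrightarrow> L"
  shows "limsup (\<lambda>n. ereal (f n)) \<le> ereal L"
proof -
  have "limsup (\<lambda>n. ereal (f n)) \<le> limsup (\<lambda>n. ereal (g n))"
    using assms(1) by (intro Limsup_mono) simp
  also have "\<dots> = ereal L"
    using assms(2) by (intro lim_imp_Limsup) auto
  finally show ?thesis .
qed

lemma liminf_ge_lim:
  assumes "\<forall>\<^sub>F n in sequentially. g n \<le> f n" "g \<longlonglongrightarrow> L"
  shows "ereal L \<le> liminf (\<lambda>n. ereal (f n))"
proof -
  have "ereal L = liminf (\<lambda>n. ereal (g n))"
    using assms(2) by (intro lim_imp_Liminf[symmetric]) auto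
  also have "\<dots> \<le> liminf (\<lambda>n. ereal (f n))"
    using assms(1) by (intro Liminf_mono) simp
  finally show ?thesis .
qed

lemma nat_ceiling_exp:
  fixes a :: real
  shows "exp a \<le> real (nat \<lceil>exp a\<rceil>)" and "real (nat \<lceil>exp a\<rceil>) \<le> exp a + 1" and "1 \<le> nat \<lceil>exp a\<rceil>"
proof -
  have "0 < \<lceil>exp a\<rceil>" by simp
  then show "exp a \<le> real (nat \<lceil>exp a\<rceil>)" "real (nat \<lceil>exp a\<rceil>) \<le> exp a + 1" "1 \<le> nat \<lceil>exp a\<rceil>"
    by linarith+
qed

text \<open>Rates are compared with an arbitrarily small loss; the loss pays for all subexponential
  factors.\<close>

lemma ereal_le_if_all_less:
  assumes "\<And>r. r < a \<Longrightarrow> ereal r \<le> b"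
  shows "ereal a \<le> b"
proof (rule dense_le)
  fix z assume "z < ereal a"
  then show "z \<le> b" using assms by (cases z) auto
qed

lemma le_ereal_if_all_greater:
  assumes "\<And>r. a < ereal r \<Longrightarrow> b \<le> ereal r"
  shows "b \<le> a"
proof (rule dense_ge)
  fix z assume "a < z"
  then show "b \<le> z" using assms by (cases z) auto
qed

text \<open>The decoding sets are numbered from 0 and the messages from 1, hence
  \<open>Suc i\<close>. Outcomes in no decoding set are decoded as message 1, so its preimage may
  exceed its set; this can only lower error probabilities.\<close>

lemma exists_decoder:
  fixes D :: "nat \<Rightarrow> 'y set"
  assumes M: "1 \<le> M" and D: "\<And>i. i < M \<Longrightarrow> D i \<in> sets N" and disj: "disjoint_family_on D {..<M}"
  obtains \<psi> where "\<psi> \<in> space N \<rightarrow> {1..M}"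
    and "\<And>i. i \<in> {1..M} \<Longrightarrow> \<psi> -` {i} \<inter> space N \<in> sets N"
    and "\<And>i y. i < M \<Longrightarrow> y \<in> D i \<Longrightarrow> \<psi> y = Suc i"
proof
  define \<psi> where "\<psi> y = (if \<exists>i<M. y \<in> D i then Suc (LEAST i. i < M \<and> y \<in> D i) else 1)" for y
  have eq: "\<psi> y = Suc i" if "i < M" "y \<in> D i" for i y
  proof -
    have "(LEAST i. i < M \<and> y \<in> D i) = i"
    proof (rule Least_equality)
      fix j assume "j < M \<and> y \<in> D j"
      with that disj have "j = i"
        by (auto simp: disjoint_family_on_def disjoint_iff)
      then show "i \<le> j" by simp
    qed (use that in simp)
    with that show ?thesis by (auto simp: \<psi>_def)
  qed
  then show "\<And>i y. i < M \<Longrightarrow> y \<in> D i \<Longrightarrow> \<psi> y = Suc i" .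
  have one: "\<psi> y = 1" if "\<And>i. i < M \<Longrightarrow> y \<notin> D i" for y
    using that by (auto simp: \<psi>_def)
  show "\<psi> \<in> space N \<rightarrow> {1..M}"
  proof
    fix y
    show "\<psi> y \<in> {1..M}"
    proof (cases "\<exists>i<M. y \<in> D i")
      case True
      then obtain i where "i < M" "y \<in> D i" by auto
      then show ?thesis using eq by auto
    next
      case False
      then have "\<psi> y = 1" using one[of y] by auto
      then show ?thesis using M by simp
    qed
  qed
  fix i assume i: "i \<in> {1..M}"
  show "\<psi> -` {i} \<inter> space N \<in> sets N"
  proof (cases "i = 1")
    case True
    \<comment> \<open>Message 1 receives \<open>D 0\<close> and all uncovered outcomes, that is, the
      complement of the other sets.\<close>
    have "\<psi> -` {i} \<inter> space N = space N - (\<Union>j\<in>{1..<M}. D j)" (is "?A = ?B")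
    proof (intro set_eqI iffI)
      fix y assume "y \<in> ?A"
      then show "y \<in> ?B" using eq[of _ y] True by fastforce
    next
      fix y assume y: "y \<in> ?B"
      show "y \<in> ?A"
      proof (cases "y \<in> D 0")
        case True
        then show ?thesis using y eq[of 0 y] M \<open>i = 1\<close> by auto
      next
        case False
        have "y \<notin> D j" if "j < M" for j
          using y that False by (cases "j = 0") auto
        then show ?thesis using y one[of y] \<open>i = 1\<close> by auto
      qed
    qed
    also have "\<dots> \<in> sets N"
      using D by (intro sets.Diff sets.finite_UN) auto
    finally show ?thesis .
  next
    case False
    with i obtain j where j: "i = Suc j" "j < M" "0 < j" by (cases i) auto
    have "\<psi> -` {i} \<inter> space N = D j" (is "?A = ?B")
    proof (intro set_eqI iffI)
      fix y assume y: "y \<in> ?A"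
      then have "\<exists>k<M. y \<in> D k"
        using one[of y] False by auto
      then obtain k where "k < M" "y \<in> D k" by auto
      then show "y \<in> ?B" using eq[of k y] y j by auto
    next
      fix y assume "y \<in> ?B"
      then show "y \<in> ?A" using eq[of j y] j D[of j] sets.sets_into_space by auto
    qed
    then show ?thesis using D j by simp
  qed
qed

section \<open>Maximal codes at a density threshold\<close>

context finite_channel
begin

lemma measure_W_le_1: "x \<in> inputs n \<Longrightarrow> measure (W n x) B \<le> 1"
  using prob_space.prob_le_1[OF prob_space_W] .

lemma measure_W_compl:
  "x \<in> inputs n \<Longrightarrow> B \<in> sets (Yn Y n) \<Longrightarrow> measure (W n x) (space (Yn Y n) - B) = 1 - measure (W n x) B"
  using prob_space.prob_compl[OF prob_space_W, of x B] by (simp add: sets_W space_W)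

lemma measure_W_mono:
  "x \<in> inputs n \<Longrightarrow> A \<subseteq> B \<Longrightarrow> B \<in> sets (Yn Y n) \<Longrightarrow> measure (W n x) A \<le> measure (W n x) B"
  using finite_measure.finite_measure_mono[OF prob_space.finite_measure[OF prob_space_W], of x A B]
  by (simp add: sets_W)

text \<open>Feinstein's maximal code argument: as long as the decoding sets chosen so far have small
  output probability, an average over the input shows that one more codeword fits.\<close>
lemma feinstein:
  assumes supp: "set_pmf Q \<subseteq> inputs n"
    and B: "\<And>x. B x \<in> sets (Yn Y n)"
    and t: "\<And>x. x \<in> set_pmf Q \<Longrightarrow> measure (outdist Y W n Q) (B x) \<le> t" "0 \<le> t"
    and e: "(\<Sum>x\<in>inputs n. pmf Q x * measure (W n x) (space (Yn Y n) - B x)) + real M * t \<le> e"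
    and "k \<le> M"
  shows "\<exists>\<phi> D. (\<forall>i<k. \<phi> i \<in> set_pmf Q \<and> D i \<in> sets (Yn Y n)
      \<and> measure (W n (\<phi> i)) (space (Yn Y n) - D i) \<le> e) \<and> disjoint_family_on D {..<k}
      \<and> measure (outdist Y W n Q) (\<Union>i<k. D i) \<le> real k * t"
  using \<open>k \<le> M\<close>
proof (induction k)
  case 0
  then show ?case by (simp add: disjoint_family_on_def)
next
  case (Suc k)
  let ?O = "outdist Y W n Q" and ?\<Omega> = "space (Yn Y n)"
  interpret O: prob_space ?O by (rule prob_space_outdist[OF supp])
  from Suc obtain \<phi> D where IH: "\<And>i. i < k \<Longrightarrow> \<phi> i \<in> set_pmf Q" "\<And>i. i < k \<Longrightarrow> D i \<in> sets (Yn Y n)"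
      "\<And>i. i < k \<Longrightarrow> measure (W n (\<phi> i)) (?\<Omega> - D i) \<le> e"
      "disjoint_family_on D {..<k}" "measure ?O (\<Union>i<k. D i) \<le> real k * t"
    by (auto simp: Suc_le_eq)
  define U where "U = (\<Union>i<k. D i)"
  have U: "U \<in> sets (Yn Y n)" unfolding U_def using IH(2) by auto
  \<comment> \<open>Making the new set disjoint from the old ones costs W^n(U|x), whose average over
    the input is the output probability of U.\<close>
  have sub: "measure (W n x) (?\<Omega> - (B x - U)) \<le> measure (W n x) (?\<Omega> - B x) + measure (W n x) U"
    if x: "x \<in> inputs n" for x
  proof -
    have "measure (W n x) (?\<Omega> - (B x - U)) \<le> measure (W n x) ((?\<Omega> - B x) \<union> U)"
      using x B U by (intro measure_W_mono) auto
    also have "\<dots> \<le> measure (W n x) (?\<Omega> - B x) + measure (W n x) U"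
      using B U x by (intro measure_Un_le) (auto simp: sets_W)
    finally show ?thesis .
  qed
  have "(\<Sum>x\<in>inputs n. pmf Q x * measure (W n x) (?\<Omega> - (B x - U))) \<le>
      (\<Sum>x\<in>inputs n. pmf Q x * (measure (W n x) (?\<Omega> - B x) + measure (W n x) U))"
    by (intro sum_mono mult_left_mono sub) auto
  also have "\<dots> = (\<Sum>x\<in>inputs n. pmf Q x * measure (W n x) (?\<Omega> - B x)) + measure ?O U"
    by (simp add: measure_outdist[OF supp U] distrib_left sum.distrib)
  \<comment> \<open>Bounding by \<open>M\<close> instead of \<open>k\<close> lets one error level
    \<open>e\<close> serve in every step of the induction.\<close>
  also have "measure ?O U \<le> real M * t"
    using IH(5) Suc.prems mult_right_mono[OF _ t(2), of "real k" "real M"] by (simp add: U_def)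
  finally have "(\<Sum>x\<in>inputs n. pmf Q x * measure (W n x) (?\<Omega> - (B x - U))) \<le> e"
    using e by simp
  then obtain x where x: "x \<in> set_pmf Q" "measure (W n x) (?\<Omega> - (B x - U)) \<le> e"
    using exists_le_average[OF supp, of "\<lambda>x. measure (W n x) (?\<Omega> - (B x - U))"] by force
  define D' where "D' = D(k := B x - U)"
  have D'U: "(\<Union>i<Suc k. D' i) = U \<union> (B x - U)"
    by (auto simp: D'_def U_def lessThan_Suc)
  have "measure ?O (U \<union> (B x - U)) \<le> measure ?O U + measure ?O (B x - U)"
    using U B by (intro measure_Un_le) auto
  also have "measure ?O (B x - U) \<le> measure ?O (B x)"
    using B by (intro O.finite_measure_mono) auto
  also have "\<dots> \<le> t" by (rule t(1)[OF x(1)])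
  finally have "measure ?O (\<Union>i<Suc k. D' i) \<le> real (Suc k) * t"
    using IH(5) unfolding D'U by (simp add: U_def algebra_simps)
  moreover have "disjoint_family_on D' {..<Suc k}"
    using IH(4) by (fastforce simp: disjoint_family_on_def D'_def U_def less_Suc_eq)
  moreover have "\<forall>i<Suc k. (\<phi>(k := x)) i \<in> set_pmf Q \<and> D' i \<in> sets (Yn Y n)
      \<and> measure (W n ((\<phi>(k := x)) i)) (?\<Omega> - D' i) \<le> e"
    using IH(1-3) x U B by (simp add: D'_def less_Suc_eq)
  ultimately show ?case by blast
qed

text \<open>Markov's inequality: on this set \<open>W n x\<close> has mass at most 1 and density at
  least \<open>a\<close>. It limits the share of the output law that one decoding set uses
  up.\<close>

lemma measure_dens_ge:
  assumes supp: "set_pmf Q \<subseteq> inputs n" and x: "x \<in> set_pmf Q" and "0 < a"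
  shows "measure (outdist Y W n Q) {y \<in> space (Yn Y n). a \<le> dens Q x y} \<le> 1 / a"
proof -
  let ?O = "outdist Y W n Q" and ?B = "{y \<in> space (Yn Y n). a \<le> dens Q x y}"
  note [measurable] = dens_measurable[OF supp]
  interpret O: prob_space ?O by (rule prob_space_outdist[OF supp])
  interpret X: prob_space "W n x" using prob_space_W x supp by auto
  have [measurable]: "?B \<in> sets (Yn Y n)" by measurable
  have "ennreal a * emeasure ?O ?B = (\<integral>\<^sup>+y. ennreal a * indicator ?B y \<partial>?O)"
    by (rule nn_integral_cmult_indicator[symmetric]) simp
  also have "\<dots> \<le> (\<integral>\<^sup>+y. ennreal (dens Q x y) * indicator ?B y \<partial>?O)"
    by (intro nn_integral_mono) (auto simp: indicator_def ennreal_leI)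
  also have "\<dots> = emeasure (W n x) ?B"
    by (subst density_W[OF supp x], subst emeasure_density) auto
  also have "\<dots> \<le> 1" by (rule X.measure_le_1)
  finally have "ennreal (a * measure ?O ?B) \<le> ennreal 1"
    using \<open>0 < a\<close> by (simp add: O.emeasure_eq_measure ennreal_mult)
  then have "a * measure ?O ?B \<le> 1" by (subst (asm) ennreal_le_iff) auto
  then show ?thesis using \<open>0 < a\<close> by (simp add: field_simps)
qed

text \<open>The first term is the average error of the threshold sets; the second bounds the output
  probability of M such sets, which is the price of making them disjoint.\<close>

lemma feinstein_code:
  assumes supp: "set_pmf Q \<subseteq> inputs n" and n: "1 \<le> n" and \<alpha>: "0 < \<alpha>" and M: "1 \<le> M"
  shows "\<exists>\<phi> \<psi>. (\<forall>i\<in>{1..M}. \<phi> i \<in> set_pmf Q) \<and> \<psi> \<in> space (Yn Y n) \<rightarrow> {1..M}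
    \<and> (\<forall>i\<in>{1..M}. \<psi> -` {i} \<inter> space (Yn Y n) \<in> sets (Yn Y n))
    \<and> trans_err Y W n M \<phi> \<psi> \<le> measure (jointdist Y W n Q)
        {z \<in> space (jointdist Y W n Q). info_dens Y W n Q z < \<alpha>} + real M * exp (- real n * \<alpha>)"
proof -
  let ?\<Omega> = "space (Yn Y n)"
  note [measurable] = dens_measurable[OF supp] info_dens_measurable[OF supp]
  define a where "a = exp (real n * \<alpha>)"
  have a: "1 < a" "0 < a" using n \<alpha> by (auto simp: a_def)
  define B where "B x = {y \<in> ?\<Omega>. a \<le> dens Q x y}" for x
  have B[measurable]: "B x \<in> sets (Yn Y n)" for x unfolding B_def by measurable
  define p where "p = measure (jointdist Y W n Q) {z \<in> space (jointdist Y W n Q). info_dens Y W n Q z < \<alpha>}"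
  define e where "e = p + real M * exp (- real n * \<alpha>)"
  \<comment> \<open>At density 0 both sides hold: \<open>info_dens\<close> is 0 there by
    \<open>ln 0 = 0\<close>, which is below \<alpha> because \<alpha> is positive.\<close>
  have iff: "info_dens Y W n Q (x, y) < \<alpha> \<longleftrightarrow> dens Q x y < a" for x y
  proof (cases "dens Q x y = 0")
    case True
    then show ?thesis using a \<alpha> by (simp add: info_dens_eq[OF supp])
  next
    case False
    then have pos: "0 < dens Q x y" using dens_nonneg[OF supp, of x y] by linarith
    have "info_dens Y W n Q (x, y) < \<alpha> \<longleftrightarrow> ln (dens Q x y) < real n * \<alpha>"
      using n by (simp add: info_dens_eq[OF supp] field_simps)
    also have "\<dots> \<longleftrightarrow> dens Q x y < a"
      using pos by (metis a_def exp_ln exp_less_cancel_iff)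
    finally show ?thesis .
  qed
  have sm: "{z \<in> space (jointdist Y W n Q). info_dens Y W n Q z < \<alpha>} \<in> sets (count_space UNIV \<Otimes>\<^sub>M Yn Y n)"
  proof -
    have "info_dens Y W n Q \<in> borel_measurable (jointdist Y W n Q)"
      by measurable
    then have "{z \<in> space (jointdist Y W n Q). info_dens Y W n Q z < \<alpha>} \<in> sets (jointdist Y W n Q)"
      by (intro borel_measurable_less borel_measurable_const)
    then show ?thesis by (simp only: sets_jointdist)
  qed
  have "Pair x -` {z \<in> space (jointdist Y W n Q). info_dens Y W n Q z < \<alpha>} \<inter> ?\<Omega> = ?\<Omega> - B x" for x
    by (auto simp: B_def iff not_le)
  then have p: "p = (\<Sum>x\<in>inputs n. pmf Q x * measure (W n x) (?\<Omega> - B x))"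
    unfolding p_def measure_jointdist[OF supp sm] by simp
  have t: "measure (outdist Y W n Q) (B x) \<le> exp (- real n * \<alpha>)" if "x \<in> set_pmf Q" for x
    using measure_dens_ge[OF supp that a(2)] by (simp add: B_def a_def exp_minus inverse_eq_divide)
  obtain \<phi> D where code: "\<And>i. i < M \<Longrightarrow> \<phi> i \<in> set_pmf Q" "\<And>i. i < M \<Longrightarrow> D i \<in> sets (Yn Y n)"
    "\<And>i. i < M \<Longrightarrow> measure (W n (\<phi> i)) (?\<Omega> - D i) \<le> e" "disjoint_family_on D {..<M}"
    using feinstein[where B = B and M = M and e = e and k = M, OF supp B t] by (auto simp: e_def p)
  obtain \<psi> where \<psi>: "\<psi> \<in> ?\<Omega> \<rightarrow> {1..M}"
    "\<And>i. i \<in> {1..M} \<Longrightarrow> \<psi> -` {i} \<inter> ?\<Omega> \<in> sets (Yn Y n)"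
    "\<And>i y. i < M \<Longrightarrow> y \<in> D i \<Longrightarrow> \<psi> y = Suc i"
    using exists_decoder[OF M code(2) code(4)] by metis
  have err: "measure (W n (\<phi> (i - 1))) (?\<Omega> - \<psi> -` {i}) \<le> e" if i: "i \<in> {1..M}" for i
  proof -
    have "measure (W n (\<phi> (i - 1))) (?\<Omega> - \<psi> -` {i}) \<le> measure (W n (\<phi> (i - 1))) (?\<Omega> - D (i - 1))"
      using i code(1,2)[of "i - 1"] supp \<psi>(3)[of "i - 1"] by (intro measure_W_mono) auto
    also have "\<dots> \<le> e" using i by (intro code) auto
    finally show ?thesis .
  qed
  have "trans_err Y W n M (\<lambda>i. \<phi> (i - 1)) \<psi> \<le> (\<Sum>i\<in>{1..M}. e) / real M"
    unfolding trans_err_def by (intro divide_right_mono sum_mono err) auto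
  then have "trans_err Y W n M (\<lambda>i. \<phi> (i - 1)) \<psi> \<le> e" using M by simp
  then show ?thesis
    using code(1) \<psi>(1,2) unfolding e_def p_def
    by (intro exI[of _ "\<lambda>i. \<phi> (i - 1)"] exI[of _ \<psi>]) auto
qed

end

text \<open>One message is always decoded correctly and has rate 0; an admissible process supplies
  its codeword. This covers the rates at which the threshold of \<open>feinstein_code\<close> is not
  known to be positive.\<close>

lemma trans_achievable_nonpos:
  fixes W :: "nat \<Rightarrow> 'a::finite list \<Rightarrow> (nat \<Rightarrow> 'b) measure"
  assumes "0 \<le> \<epsilon>" "R \<le> 0" "S_Gamma c \<Gamma> \<noteq> {}"
  shows "trans_achievable Y W c \<Gamma> \<epsilon> R"
proof -
  from assms obtain PX where PX: "PX \<in> S_Gamma c \<Gamma>" by auto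
  define x where "x n = (SOME x. x \<in> set_pmf (PX n))" for n
  have "x n \<in> set_pmf (PX n)" for n
    unfolding x_def by (rule someI_ex) (use set_pmf_not_empty in fastforce)
  with PX have x: "x n \<in> costset c \<Gamma> n" if "1 \<le> n" for n
    using that by (auto simp: S_Gamma_def)
  have "trans_err Y W n 1 (\<lambda>_. x n) (\<lambda>_. 1) = 0" for n
    unfolding trans_err_def by simp
  moreover have "liminf (\<lambda>n. ereal (ln (real 1) / real n)) = 0"
    by (simp add: Liminf_const flip: zero_ereal_def)
  ultimately show ?thesis
    unfolding trans_achievable_def using x assms
    by (intro exI[of _ "\<lambda>_. 1"] exI[of _ "\<lambda>n _. x n"] exI[of _ "\<lambda>_ _. 1"])
       (auto simp: Limsup_const simp flip: zero_ereal_def)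
qed

lemma I_lower_le_C_s:
  fixes W :: "nat \<Rightarrow> 'a::finite list \<Rightarrow> (nat \<Rightarrow> 'b) measure"
  assumes chan: "general_channel Y W" and \<epsilon>: "0 \<le> \<epsilon>" and PX: "PX \<in> S_Gamma c \<Gamma>"
  shows "I_lower Y W PX \<le> C_s Y W c \<Gamma> \<epsilon>"
  unfolding I_lower_def p_liminf_def
proof (rule Sup_least, safe, rule ereal_le_if_all_less)
  fix \<alpha> R :: real
  define p where "p n = measure (jointdist Y W n (PX n))
    {z \<in> space (jointdist Y W n (PX n)). info_dens Y W n (PX n) z < \<alpha>}" for n
  assume "(\<lambda>n. measure (jointdist Y W n (PX n))
    {z \<in> space (jointdist Y W n (PX n)). info_dens Y W n (PX n) z < \<alpha>}) \<longlonglongrightarrow> 0" and R: "R < \<alpha>"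
  then have p: "p \<longlonglongrightarrow> 0" by (simp add: p_def[abs_def])
  have "trans_achievable Y W c \<Gamma> \<epsilon> R"
  proof (cases "R \<le> 0")
    case True
    then show ?thesis using trans_achievable_nonpos[OF \<epsilon> True, of c \<Gamma> Y W] PX by auto
  next
    case False
    \<comment> \<open>Rounding up makes the rate at least R. In this branch 0 < R < \<alpha>, so
      that \<open>feinstein_code\<close> applies and M n * exp (- n \<alpha>) vanishes.\<close>
    define M where "M n = nat \<lceil>exp (real n * R)\<rceil>" for n
    have Mge: "exp (real n * R) \<le> real (M n)" and Mle: "real (M n) \<le> exp (real n * R) + 1"
      and M1: "1 \<le> M n" for n
      unfolding M_def by (rule nat_ceiling_exp)+
    have supp: "set_pmf (PX n) \<subseteq> costset c \<Gamma> n" if "1 \<le> n" for n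
      using PX that by (auto simp: S_Gamma_def)
    have "\<exists>\<phi> \<psi>. (\<forall>i\<in>{1..M n}. \<phi> i \<in> set_pmf (PX n)) \<and> \<psi> \<in> space (Yn Y n) \<rightarrow> {1..M n}
        \<and> (\<forall>i\<in>{1..M n}. \<psi> -` {i} \<inter> space (Yn Y n) \<in> sets (Yn Y n))
        \<and> trans_err Y W n (M n) \<phi> \<psi> \<le> p n + real (M n) * exp (- real n * \<alpha>)" if n: "1 \<le> n" for n
      unfolding p_def
      using order_trans[OF supp[OF n] costset_subset_inputs] n False R M1
      by (intro finite_channel.feinstein_code finite_channel.intro chan) auto
    then obtain \<phi> \<psi> where code: "\<And>n. 1 \<le> n \<Longrightarrow> (\<forall>i\<in>{1..M n}. \<phi> n i \<in> set_pmf (PX n))"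
      "\<And>n. 1 \<le> n \<Longrightarrow> \<psi> n \<in> space (Yn Y n) \<rightarrow> {1..M n}"
      "\<And>n. 1 \<le> n \<Longrightarrow> (\<forall>i\<in>{1..M n}. \<psi> n -` {i} \<inter> space (Yn Y n) \<in> sets (Yn Y n))"
      "\<And>n. 1 \<le> n \<Longrightarrow> trans_err Y W n (M n) (\<phi> n) (\<psi> n) \<le> p n + real (M n) * exp (- real n * \<alpha>)"
      by metis
    have "limsup (\<lambda>n. ereal (trans_err Y W n (M n) (\<phi> n) (\<psi> n))) \<le> ereal 0"
    proof (rule limsup_le_lim)
      show "\<forall>\<^sub>F n in sequentially. trans_err Y W n (M n) (\<phi> n) (\<psi> n) \<le>
          p n + (exp (real n * (R - \<alpha>)) + exp (- real n * \<alpha>))"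
        using eventually_ge_at_top[of 1]
      proof eventually_elim
        case (elim n)
        have "real (M n) * exp (- real n * \<alpha>) \<le> (exp (real n * R) + 1) * exp (- real n * \<alpha>)"
          by (intro mult_right_mono Mle) simp
        also have "\<dots> = exp (real n * (R - \<alpha>)) + exp (- real n * \<alpha>)"
          by (simp add: distrib_right right_diff_distrib flip: exp_add)
        finally show ?case using code(4)[OF elim] by simp
      qed
      have "(\<lambda>n. exp (real n * (R - \<alpha>))) \<longlonglongrightarrow> 0" "(\<lambda>n. exp (- real n * \<alpha>)) \<longlonglongrightarrow> 0"
        using R False by real_asymp+
      from tendsto_add[OF p tendsto_add[OF this]] show "(\<lambda>n. p n + (exp (real n * (R - \<alpha>)) + exp (- real n * \<alpha>))) \<longlonglongrightarrow> 0"
        by simp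
    qed
    moreover have "ereal R \<le> liminf (\<lambda>n. ereal (ln (real (M n)) / real n))"
    proof (rule liminf_ge_lim)
      show "\<forall>\<^sub>F n in sequentially. R \<le> ln (real (M n)) / real n"
        using eventually_ge_at_top[of 1]
      proof eventually_elim
        case (elim n)
        have "real n * R \<le> ln (real (M n))"
          using Mge[of n] M1[of n] by (subst ln_ge_iff) auto
        then show ?case using elim by (simp add: field_simps)
      qed
    qed simp
    moreover have "\<forall>i\<in>{1..M n}. \<phi> n i \<in> costset c \<Gamma> n" if "1 \<le> n" for n
      using code(1)[OF that] supp[OF that] by auto
    moreover have "ereal 0 \<le> ereal \<epsilon>" using \<epsilon> by simp
    ultimately have "(\<forall>n\<ge>1. M n \<ge> 1 \<and> (\<forall>i\<in>{1..M n}. \<phi> n i \<in> costset c \<Gamma> n)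
           \<and> \<psi> n \<in> space (Yn Y n) \<rightarrow> {1..M n}
           \<and> (\<forall>i\<in>{1..M n}. \<psi> n -` {i} \<inter> space (Yn Y n) \<in> sets (Yn Y n)))
      \<and> limsup (\<lambda>n. ereal (trans_err Y W n (M n) (\<phi> n) (\<psi> n))) \<le> ereal \<epsilon>
      \<and> liminf (\<lambda>n. ereal (ln (real (M n)) / real n)) \<ge> ereal R"
      using M1 code(2,3) by (intro conjI allI impI) (assumption | rule order_trans | blast)+
    then show ?thesis
      unfolding trans_achievable_def by blast
  qed
  then show "ereal R \<le> C_s Y W c \<Gamma> \<epsilon>"
    unfolding C_s_def by (intro Sup_upper) auto
qed

section \<open>From transmission to identification\<close>

lemma limsup_le_perturb:
  fixes f g h :: "nat \<Rightarrow> real"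
  assumes "\<forall>\<^sub>F n in sequentially. f n \<le> g n + h n" "h \<longlonglongrightarrow> 0" "limsup (\<lambda>n. ereal (g n)) \<le> ereal L"
  shows "limsup (\<lambda>n. ereal (f n)) \<le> ereal L"
proof (rule le_ereal_if_all_greater)
  fix r assume "ereal L < ereal r"
  then have lr: "L < r" by simp
  have "\<forall>\<^sub>F n in sequentially. h n < (r - L) / 2"
    using order_tendstoD(2)[OF assms(2), of "(r - L) / 2"] lr by simp
  moreover have "\<forall>\<^sub>F n in sequentially. ereal (g n) < ereal ((L + r) / 2)"
    using assms(3)[unfolded Limsup_le_iff, rule_format, of "ereal ((L + r) / 2)"] lr by simp
  ultimately have "\<forall>\<^sub>F n in sequentially. ereal (f n) \<le> ereal r"
    using assms(1)
  proof eventually_elim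
    case (elim n)
    then show ?case by (simp add: field_simps)
  qed
  then show "limsup (\<lambda>n. ereal (f n)) \<le> ereal r"
    by (rule Limsup_bounded)
qed

text \<open>This is \<open>s\<close> minus the Hamming distance. Each agreement will be a codeword
  shared by two identification messages.\<close>

definition agreements :: "nat \<Rightarrow> (nat \<Rightarrow> nat) \<Rightarrow> (nat \<Rightarrow> nat) \<Rightarrow> nat" where
  "agreements s f g = card {i \<in> {..<s}. f i = g i}"

text \<open>Union bound over the coordinate sets I with at least s/m elements: there are at most 2^s
  of them, and prescribing the letters on I divides the number of words by 4^(m |I|), which is at
  least 4^s.\<close>

lemma card_many_agreements:
  assumes f: "f \<in> {..<s} \<rightarrow>\<^sub>E {..<4 ^ m}"
  shows "card {g \<in> {..<s} \<rightarrow>\<^sub>E {..<4 ^ m}. s \<le> m * agreements s f g} * 2 ^ s \<le> (4 ^ m) ^ s"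
proof -
  let ?F = "{..<s} \<rightarrow>\<^sub>E {..<4 ^ m :: nat}" and ?q = "4 ^ m :: nat"
  define \<I> where "\<I> = {I. I \<subseteq> {..<s} \<and> s \<le> m * card I}"
  define G where "G I = PiE {..<s} (\<lambda>i. if i \<in> I then {f i} else {..<?q})" for I
  have fin: "finite \<I>" unfolding \<I>_def by (rule finite_subset[of _ "Pow {..<s}"]) auto
  have cardI: "card \<I> \<le> 2 ^ s"
    using card_mono[of "Pow {..<s}" \<I>] by (auto simp: \<I>_def card_Pow)
  have G: "card (G I) * 4 ^ s \<le> ?q ^ s" if "I \<in> \<I>" for I
  proof -
    have I: "I \<subseteq> {..<s}" "s \<le> m * card I" using that by (auto simp: \<I>_def)
    have "card (G I) = (\<Prod>i<s. if i \<in> I then 1 else ?q)"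
      unfolding G_def by (subst card_PiE) (auto intro!: prod.cong)
    also have "\<dots> = ?q ^ card ({..<s} - I)"
      by (subst prod.If_cases) (auto simp: Diff_eq)
    also have "card ({..<s} - I) = s - card I"
      using I by (subst card_Diff_subset) (auto intro: finite_subset)
    finally have "card (G I) * 4 ^ s \<le> ?q ^ (s - card I) * ?q ^ card I"
      using I(2) by (simp add: power_increasing flip: power_mult)
    also have "\<dots> = ?q ^ s"
      using card_mono[OF _ I(1)] by (simp flip: power_add)
    finally show ?thesis .
  qed
  have "{g \<in> ?F. s \<le> m * agreements s f g} \<subseteq> (\<Union>I\<in>\<I>. G I)"
  proof
    fix g assume "g \<in> {g \<in> ?F. s \<le> m * agreements s f g}"
    then show "g \<in> (\<Union>I\<in>\<I>. G I)"
      by (intro UN_I[of "{i \<in> {..<s}. f i = g i}"]) (auto simp: \<I>_def G_def agreements_def PiE_iff)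
  qed
  moreover have "finite (G I)" for I
    unfolding G_def by (intro finite_PiE) auto
  ultimately have "card {g \<in> ?F. s \<le> m * agreements s f g} \<le> card (\<Union>I\<in>\<I>. G I)"
    using fin by (intro card_mono) auto
  also have "\<dots> \<le> (\<Sum>I\<in>\<I>. card (G I))"
    by (rule card_UN_le[OF fin])
  finally have "card {g \<in> ?F. s \<le> m * agreements s f g} * 4 ^ s \<le> (\<Sum>I\<in>\<I>. card (G I) * 4 ^ s)"
    by (simp flip: sum_distrib_right)
  also have "\<dots> \<le> card \<I> * ?q ^ s"
    using sum_bounded_above[of \<I> "\<lambda>I. card (G I) * 4 ^ s" "?q ^ s"] G by simp
  also have "\<dots> \<le> 2 ^ s * ?q ^ s" using cardI by simp
  finally have *: "card {g \<in> ?F. s \<le> m * agreements s f g} * 4 ^ s \<le> 2 ^ s * ?q ^ s" .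
  have "(4 :: nat) ^ s = 2 ^ s * 2 ^ s"
    by (simp flip: power_mult_distrib)
  with * have "(card {g \<in> ?F. s \<le> m * agreements s f g} * 2 ^ s) * 2 ^ s \<le> ?q ^ s * 2 ^ s"
    by (simp only: mult.assoc mult.commute[of "2 ^ s" "?q ^ s"])
  then show ?thesis by simp
qed

text \<open>A Gilbert-Varshamov code: words are added greedily, the excluded balls being too small to
  exhaust all words.\<close>
lemma gilbert_code:
  fixes k :: nat
  shows "k \<le> 2 ^ s \<Longrightarrow> \<exists>G. (\<forall>i<k. G i \<in> {..<s} \<rightarrow>\<^sub>E {..<4 ^ m})
    \<and> (\<forall>i<k. \<forall>j<i. m * agreements s (G j) (G i) < s)"
proof (induction k)
  case (Suc k)
  let ?F = "{..<s} \<rightarrow>\<^sub>E {..<4 ^ m :: nat}"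
  from Suc obtain G where G': "\<forall>i<k. G i \<in> ?F" "\<forall>i<k. \<forall>j<i. m * agreements s (G j) (G i) < s"
    using Suc_leD by blast
  then have G: "\<And>i. i < k \<Longrightarrow> G i \<in> ?F"
    "\<And>i j. i < k \<Longrightarrow> j < i \<Longrightarrow> m * agreements s (G j) (G i) < s" by blast+
  define B where "B i = {g \<in> ?F. s \<le> m * agreements s (G i) g}" for i
  have finF: "finite ?F" by (intro finite_PiE) auto
  have "card (\<Union>i<k. B i) * 2 ^ s \<le> (\<Sum>i<k. card (B i) * 2 ^ s)"
    using card_UN_le[of "{..<k}" B] by (simp flip: sum_distrib_right)
  also have "\<dots> \<le> k * (4 ^ m) ^ s"
    using sum_bounded_above[of "{..<k}" "\<lambda>i. card (B i) * 2 ^ s" "(4 ^ m) ^ s"]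
      card_many_agreements G(1) by (simp add: B_def)
  also have "\<dots> < 2 ^ s * (4 ^ m) ^ s"
    using Suc.prems by (intro mult_strict_right_mono) auto
  finally have "card (\<Union>i<k. B i) < (4 ^ m) ^ s" by simp
  also have "\<dots> = card ?F" by (subst card_PiE) auto
  finally have "\<not> ?F \<subseteq> (\<Union>i<k. B i)"
    using card_mono[of "\<Union>i<k. B i" ?F] finF by (auto simp: B_def not_le)
  then obtain g where g: "g \<in> ?F" "g \<notin> (\<Union>i<k. B i)" by blast
  then have "\<And>i. i < k \<Longrightarrow> m * agreements s (G i) g < s"
    by (auto simp: B_def not_le)
  with G g(1) show ?case
    by (intro exI[of _ "G(k := g)"]) (auto simp: less_Suc_eq)
qed auto

lemma finite_id_lambda_set:
  fixes N :: nat
  shows "finite {measure (outdist Y W n (Q j)) (D i) |i j. i \<in> {1..N} \<and> j \<in> {1..N} \<and> i \<noteq> j}"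
proof (rule finite_subset)
  show "{measure (outdist Y W n (Q j)) (D i) |i j. i \<in> {1..N} \<and> j \<in> {1..N} \<and> i \<noteq> j} \<subseteq>
      (\<lambda>(i, j). measure (outdist Y W n (Q j)) (D i)) ` ({1..N} \<times> {1..N})" by auto
qed auto

section \<open>Expurgation and identification codes at a fixed block length\<close>

context finite_channel
begin

text \<open>By Markov's inequality at most a share n/(n+1) of the codewords has an error above (1 +
  1/n) times the average. The factor n + 1 lost in size does not affect the rate.\<close>

lemma expurgate:
  assumes n: "1 \<le> n"
  shows "M \<le> (n + 1) * card {j \<in> {1..M}. measure (W n (\<phi> j)) (space (Yn Y n) - \<psi> -` {j})
    \<le> (1 + 1 / real n) * trans_err Y W n M \<phi> \<psi>}" (is "_ \<le> _ * card ?J")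
proof (cases "M = 0")
  case False
  define err where "err j = measure (W n (\<phi> j)) (space (Yn Y n) - \<psi> -` {j})" for j
  define \<epsilon> where "\<epsilon> = trans_err Y W n M \<phi> \<psi>"
  have sum: "(\<Sum>j\<in>{1..M}. err j) = real M * \<epsilon>"
    using False by (simp add: \<epsilon>_def trans_err_def err_def)
  have nn: "0 \<le> err j" for j by (simp add: err_def)
  define K where "K = {1..M} - ?J"
  have K: "K \<subseteq> {1..M}" "\<And>j. j \<in> K \<Longrightarrow> (1 + 1 / real n) * \<epsilon> < err j"
    by (auto simp: K_def err_def \<epsilon>_def)
  have cK: "real (card K) * (1 + 1 / real n) \<le> real M"
  \<comment> \<open>Markov's inequality has to be divided by the average error. If that is 0, all
    individual errors vanish and none exceeds the level strictly.\<close>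
  proof (cases "\<epsilon> = 0")
    case True
    then have "err j = 0" if "j \<in> {1..M}" for j
      using sum nn that sum_nonneg_eq_0_iff[of "{1..M}" err] by auto
    then have "K = {}" using K True by fastforce
    then show ?thesis by simp
  next
    case False
    have "0 \<le> real M * \<epsilon>" unfolding sum[symmetric] by (intro sum_nonneg nn)
    then have \<epsilon>: "0 < \<epsilon>" using False \<open>M \<noteq> 0\<close> by (simp add: zero_le_mult_iff)
    have "real (card K) * ((1 + 1 / real n) * \<epsilon>) \<le> (\<Sum>j\<in>K. err j)"
      using sum_bounded_below[of K "(1 + 1 / real n) * \<epsilon>" err] K(2) by (simp add: less_imp_le)
    also have "\<dots> \<le> (\<Sum>j\<in>{1..M}. err j)"
      using K(1) nn by (intro sum_mono2) auto
    also have "\<dots> = real M * \<epsilon>" by (rule sum)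
    finally have "(real (card K) * (1 + 1 / real n)) * \<epsilon> \<le> real M * \<epsilon>"
      by (simp only: mult.assoc)
    then show ?thesis using \<epsilon> by (simp only: mult_le_cancel_right_pos)
  qed
  have "real (card K) * (real n + 1) \<le> real M * real n"
    using cK n by (simp add: field_simps)
  then have "real (card K * (n + 1)) \<le> real (M * n)" by (simp add: algebra_simps)
  then have cK': "card K * (n + 1) \<le> M * n" by (simp only: of_nat_le_iff)
  have JM: "?J \<subseteq> {1..M}" by auto
  have "card K = card {1..M} - card ?J"
    unfolding K_def by (rule card_Diff_subset[OF finite_subset[OF JM] JM]) simp
  moreover have "card ?J \<le> card {1..M}"
    by (rule card_mono[OF _ JM]) simp
  ultimately have "card ?J + card K = M"
    by simp
  then have "(card ?J + card K) * (n + 1) = M * (n + 1)" by simp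
  with cK' show ?thesis by (simp add: algebra_simps)
qed simp

text \<open>Codewords are told apart by their indices, whose decoding sets are disjoint. A codeword
  of message b that also belongs to message a may hit \<open>D a\<close> with probability up to 1,
  but these make up less than a share 1/m; any other codeword of b reaches \<open>D a\<close> only
  through a decoding error, of probability at most \<open>e\<close>.\<close>

lemma ident_code_from_trans_code:
  assumes n: "1 \<le> n" and M: "1 \<le> M" and s: "1 \<le> s" and m: "1 \<le> m"
    and size: "(n + 1) * (s * 4 ^ m) \<le> M"
    and \<phi>: "\<And>i. i \<in> {1..M} \<Longrightarrow> \<phi> i \<in> inputs n"
    and \<psi>: "\<And>i. i \<in> {1..M} \<Longrightarrow> \<psi> -` {i} \<inter> space (Yn Y n) \<in> sets (Yn Y n)"
  shows "\<exists>Q D. (\<forall>i\<in>{1..2 ^ s}. set_pmf (Q i) \<subseteq> \<phi> ` {1..M} \<and> D i \<in> sets (Yn Y n))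
    \<and> id_mu Y W n (2 ^ s) Q D \<le> (1 + 1 / real n) * trans_err Y W n M \<phi> \<psi>
    \<and> id_lambda Y W n (2 ^ s) Q D \<le> 1 / real m + (1 + 1 / real n) * trans_err Y W n M \<phi> \<psi>"
proof -
  let ?\<Omega> = "space (Yn Y n)"
  define e where "e = (1 + 1 / real n) * trans_err Y W n M \<phi> \<psi>"
  define J where "J = {j \<in> {1..M}. measure (W n (\<phi> j)) (?\<Omega> - \<psi> -` {j}) \<le> e}"
  have e0: "0 \<le> e" by (simp add: e_def trans_err_def sum_nonneg)
  have J: "J \<subseteq> {1..M}" "\<And>j. j \<in> J \<Longrightarrow> measure (W n (\<phi> j)) (?\<Omega> - \<psi> -` {j}) \<le> e"
    by (auto simp: J_def)
  have "(n + 1) * (s * 4 ^ m) \<le> (n + 1) * card J"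
    using size expurgate[OF n, of M \<phi> \<psi>] unfolding J_def e_def by (rule order_trans)
  then have "card ({..<s} \<times> {..<4 ^ m :: nat}) \<le> card J"
    by (simp only: mult_le_cancel1 card_cartesian_product card_lessThan)
  then obtain k where k: "k ` ({..<s} \<times> {..<4 ^ m :: nat}) \<subseteq> J" "inj_on k ({..<s} \<times> {..<4 ^ m})"
    using card_le_inj[of "{..<s} \<times> {..<4 ^ m :: nat}" J] J(1) by (auto intro: finite_subset)
  obtain G where "\<forall>i<(2::nat) ^ s. G i \<in> {..<s} \<rightarrow>\<^sub>E {..<4 ^ m :: nat}"
    "\<forall>i<2 ^ s. \<forall>j<i. m * agreements s (G j) (G i) < s"
    using gilbert_code[OF order_refl, of s m] by blast
  then have G: "\<And>i. i < 2 ^ s \<Longrightarrow> G i \<in> {..<s} \<rightarrow>\<^sub>E {..<4 ^ m}"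
    "\<And>i j. i < 2 ^ s \<Longrightarrow> j < i \<Longrightarrow> m * agreements s (G j) (G i) < s"
    by blast+
  \<comment> \<open>The index of the codeword that message a uses in row i; messages are numbered
    from 1, the words \<open>G\<close> from 0.\<close>
  define w where "w a i = k (i, G (a - 1) i)" for a i
  define Q where "Q a = map_pmf (\<lambda>i. \<phi> (w a i)) (pmf_of_set {..<s})" for a
  define D where "D a = (\<Union>i<s. \<psi> -` {w a i} \<inter> ?\<Omega>)" for a
  have Gm: "G (a - 1) i < 4 ^ m" if "a \<in> {1..2 ^ s}" "i < s" for a i
    using G(1)[of "a - 1"] that by (auto simp: PiE_iff)
  have wJ: "w a i \<in> J" if "a \<in> {1..2 ^ s}" "i < s" for a i
    using k(1) Gm[OF that] that by (auto simp: w_def)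
  then have wM: "w a i \<in> {1..M}" if "a \<in> {1..2 ^ s}" "i < s" for a i
    using J(1) that by blast
  have D: "D a \<in> sets (Yn Y n)" if "a \<in> {1..2 ^ s}" for a
    unfolding D_def using wM[OF that] \<psi> by (intro sets.finite_UN) auto
  have "0 \<in> {..<s}" using s by simp
  then have ne: "{..<s} \<noteq> {}" by blast
  have QB: "measure (outdist Y W n (Q a)) B = (\<Sum>i<s. measure (W n (\<phi> (w a i))) B) / real s"
    if "a \<in> {1..2 ^ s}" "B \<in> sets (Yn Y n)" for a B
    unfolding Q_def using measure_outdist_uniform[of "{..<s}" "\<lambda>i. \<phi> (w a i)" B] ne that \<phi> wM
    by (simp add: image_subset_iff)
  have mu: "measure (outdist Y W n (Q a)) (?\<Omega> - D a) \<le> e" if a: "a \<in> {1..2 ^ s}" for a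
  proof -
    have "measure (W n (\<phi> (w a i))) (?\<Omega> - D a) \<le> e" if i: "i < s" for i
    proof -
      have "?\<Omega> - \<psi> -` {w a i} = ?\<Omega> - (\<psi> -` {w a i} \<inter> ?\<Omega>)" by auto
      then have "?\<Omega> - \<psi> -` {w a i} \<in> sets (Yn Y n)"
        using \<psi>[OF wM[OF a i]] by auto
      then have "measure (W n (\<phi> (w a i))) (?\<Omega> - D a) \<le> measure (W n (\<phi> (w a i))) (?\<Omega> - \<psi> -` {w a i})"
        using i \<phi> wM[OF a i] by (intro measure_W_mono) (auto simp: D_def)
      also have "\<dots> \<le> e" by (rule J(2)[OF wJ[OF a i]])
      finally show ?thesis .
    qed
    then have "(\<Sum>i<s. measure (W n (\<phi> (w a i))) (?\<Omega> - D a)) \<le> real s * e"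
      using sum_bounded_above[of "{..<s}" _ e] by simp
    then show ?thesis
      using s a D[OF a] by (simp add: QB field_simps)
  qed
  have agree: "m * agreements s (G (a - 1)) (G (b - 1)) < s"
    if ab: "a \<in> {1..2 ^ s}" "b \<in> {1..2 ^ s}" "a \<noteq> b" for a b
  proof -
    have sym: "agreements s (G (a - 1)) (G (b - 1)) = agreements s (G (b - 1)) (G (a - 1))"
      unfolding agreements_def by (intro arg_cong[where f = card]) auto
    consider "a - 1 < b - 1" | "b - 1 < a - 1" using ab by force
    then show ?thesis
    proof cases
      case 1
      then show ?thesis using ab by (intro G(2)) auto
    next
      case 2
      then show ?thesis unfolding sym using ab by (intro G(2)) auto
    qed
  qed
  have lam: "measure (outdist Y W n (Q b)) (D a) \<le> 1 / real m + e"
    if ab: "a \<in> {1..2 ^ s}" "b \<in> {1..2 ^ s}" "a \<noteq> b" for a b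
  proof -
    have "measure (W n (\<phi> (w b i))) (D a) \<le> of_bool (G (a - 1) i = G (b - 1) i) + e" if i: "i < s" for i
    proof (cases "G (a - 1) i = G (b - 1) i")
      case True
      have "measure (W n (\<phi> (w b i))) (D a) \<le> 1"
        using \<phi> wM[OF ab(2) i] by (intro measure_W_le_1)
      then show ?thesis using True e0 by simp
    next
      case False
      \<comment> \<open>Entries in different rows differ as well, since \<open>k\<close> is
        injective on the whole grid; only an agreement in row i itself could make this a codeword of
        message a.\<close>
      have "w a i' \<noteq> w b i" if i': "i' < s" for i'
      proof
        assume "w a i' = w b i"
        then have "(i', G (a - 1) i') = (i, G (b - 1) i)"
          using k(2) i i' Gm[OF ab(1) i'] Gm[OF ab(2) i] by (auto simp: w_def dest!: inj_onD)
        then show False using False by auto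
      qed
      then have "D a \<subseteq> ?\<Omega> - \<psi> -` {w b i}" unfolding D_def by fastforce
      moreover have "?\<Omega> - \<psi> -` {w b i} = ?\<Omega> - (\<psi> -` {w b i} \<inter> ?\<Omega>)" by auto
      then have "?\<Omega> - \<psi> -` {w b i} \<in> sets (Yn Y n)"
        using \<psi>[OF wM[OF ab(2) i]] by auto
      ultimately have "measure (W n (\<phi> (w b i))) (D a) \<le> measure (W n (\<phi> (w b i))) (?\<Omega> - \<psi> -` {w b i})"
        using \<phi> wM[OF ab(2) i] by (intro measure_W_mono) auto
      also have "\<dots> \<le> e" by (rule J(2)[OF wJ[OF ab(2) i]])
      finally show ?thesis using False by simp
    qed
    then have "(\<Sum>i<s. measure (W n (\<phi> (w b i))) (D a)) \<le>
        (\<Sum>i<s. of_bool (G (a - 1) i = G (b - 1) i) + e)"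
      by (intro sum_mono) auto
    also have "\<dots> = real (agreements s (G (a - 1)) (G (b - 1))) + real s * e"
      by (simp add: sum.distrib agreements_def Int_def)
    also have "real (agreements s (G (a - 1)) (G (b - 1))) \<le> real s / real m"
    proof -
      have "real (m * agreements s (G (a - 1)) (G (b - 1))) \<le> real s"
        using agree[OF ab] by (intro of_nat_mono) simp
      then show ?thesis using m by (simp add: field_simps)
    qed
    finally show ?thesis
      using s m D[OF ab(1)] ab(2) by (simp add: QB field_simps)
  qed
  have "id_mu Y W n (2 ^ s) Q D \<le> e"
    unfolding id_mu_def using mu by (subst Max_le_iff) auto
  moreover have "id_lambda Y W n (2 ^ s) Q D \<le> 1 / real m + e"
    unfolding id_lambda_def using lam e0 finite_id_lambda_set[of Y W n Q D "2 ^ s"]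
    by (subst Max_le_iff) auto
  moreover have "set_pmf (Q a) \<subseteq> \<phi> ` {1..M}" if "a \<in> {1..2 ^ s}" for a
    using wM[OF that] ne by (auto simp: Q_def)
  ultimately show ?thesis using D unfolding e_def by blast
qed

end

text \<open>A single message has rate \<open>ln (ln 1) = ln 0 = 0\<close>.\<close>
lemma ident_achievable_nonpos:
  fixes W :: "nat \<Rightarrow> 'a::finite list \<Rightarrow> (nat \<Rightarrow> 'b) measure"
  assumes "0 \<le> \<mu>" "0 \<le> lam" "R \<le> 0" "\<And>n. 1 \<le> n \<Longrightarrow> x n \<in> costset c \<Gamma> n"
  shows "ident_achievable Y W c \<Gamma> \<mu> lam R"
proof -
  have "id_mu Y W n 1 (\<lambda>_. return_pmf (x n)) (\<lambda>_. space (Yn Y n)) = 0" for n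
    by (simp add: id_mu_def)
  moreover have "id_lambda Y W n 1 (\<lambda>_. return_pmf (x n)) (\<lambda>_. space (Yn Y n)) = 0" for n
    by (auto simp: id_lambda_def)
  ultimately show ?thesis
    unfolding ident_achievable_def using assms
    by (intro exI[of _ "\<lambda>_. 1"] exI[of _ "\<lambda>n _. return_pmf (x n)"] exI[of _ "\<lambda>n _. space (Yn Y n)"])
       (auto simp: Limsup_const Liminf_const simp flip: zero_ereal_def)
qed

lemma trans_achievable_imp_ident_achievable:
  fixes W :: "nat \<Rightarrow> 'a::finite list \<Rightarrow> (nat \<Rightarrow> 'b) measure"
  assumes chan: "general_channel Y W" and nonneg: "0 \<le> \<mu>" "0 \<le> lam" and le: "\<epsilon> \<le> \<mu>" "\<epsilon> \<le> lam"
    and tr: "trans_achievable Y W c \<Gamma> \<epsilon> R" and R: "R' < R"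
  shows "ident_achievable Y W c \<Gamma> \<mu> lam R'"
proof -
  obtain M \<phi> \<psi> where M1: "\<And>n. 1 \<le> n \<Longrightarrow> 1 \<le> M n"
    and \<phi>: "\<And>n i. 1 \<le> n \<Longrightarrow> i \<in> {1..M n} \<Longrightarrow> \<phi> n i \<in> costset c \<Gamma> n"
    and \<psi>: "\<And>n i. 1 \<le> n \<Longrightarrow> i \<in> {1..M n} \<Longrightarrow> \<psi> n -` {i} \<inter> space (Yn Y n) \<in> sets (Yn Y n)"
    and err: "limsup (\<lambda>n. ereal (trans_err Y W n (M n) (\<phi> n) (\<psi> n))) \<le> ereal \<epsilon>"
    and rate: "ereal R \<le> liminf (\<lambda>n. ereal (ln (real (M n)) / real n))"
    using tr unfolding trans_achievable_def by blast
  show ?thesis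
  proof (cases "R' \<le> 0")
    case True
    have "\<phi> n 1 \<in> costset c \<Gamma> n" if "1 \<le> n" for n
      using \<phi>[OF that, of 1] M1[OF that] by simp
    then show ?thesis by (rule ident_achievable_nonpos[OF nonneg True])
  next
    case False
    \<comment> \<open>With 2^(s n) messages the doubly logarithmic rate is R' up to the vanishing
      term ln (ln 2) / n.\<close>
    define s where "s n = nat \<lceil>exp (real n * R')\<rceil>" for n
    \<comment> \<open>Any m n that tends to infinity with m n / n tending to 0 would serve: 1 / m n
      must vanish in the second error, and 4^(m n) must be swallowed by exp (n (R - R')).\<close>
    define m where "m n = nat \<lfloor>sqrt (real n)\<rfloor>" for n
    \<comment> \<open>The array fits into the expurgated code for all large n; at the remaining
      block lengths a one-message code is inserted.\<close>
    define ok where "ok n \<longleftrightarrow> 1 \<le> n \<and> (n + 1) * (s n * 4 ^ m n) \<le> M n" for n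
    have sge: "exp (real n * R') \<le> real (s n)" and sle: "real (s n) \<le> exp (real n * R') + 1"
      and s1: "1 \<le> s n" for n
      unfolding s_def by (rule nat_ceiling_exp)+
    have m1: "1 \<le> m n" if "1 \<le> n" for n
    proof -
      have "1 \<le> sqrt (real n)" using that by simp
      then show ?thesis unfolding m_def by (simp add: le_nat_iff le_floor_iff)
    qed
    have mle: "real (m n) \<le> sqrt (real n)" for n
      unfolding m_def by simp
    have ev: "\<forall>\<^sub>F n in sequentially. ok n"
    proof -
      define r where "r = (R' + R) / 2"
      have r: "R' < r" "r < R" using R by (auto simp: r_def)
      have "ereal r < liminf (\<lambda>n. ereal (ln (real (M n)) / real n))"
        using r(2) rate by (meson ereal_less_eq(3) less_ereal.simps(1) order_less_le_trans)
      then have "\<forall>\<^sub>F n in sequentially. ereal r < ereal (ln (real (M n)) / real n)"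
        by (rule less_LiminfD)
      moreover have "\<forall>\<^sub>F n in sequentially.
          (real n + 1) * ((exp (real n * R') + 1) * exp (sqrt (real n) * ln 4)) \<le> exp (real n * r)"
      proof -
        have "(\<lambda>n. (real n + 1) * ((exp (real n * R') + 1) * exp (sqrt (real n) * ln 4)) / exp (real n * r)) \<longlonglongrightarrow> 0"
          using r False by real_asymp
        then have "\<forall>\<^sub>F n in sequentially. (real n + 1) * ((exp (real n * R') + 1) * exp (sqrt (real n) * ln 4)) / exp (real n * r) < 1"
          by (rule order_tendstoD) simp
        then show ?thesis by eventually_elim (simp add: field_simps)
      qed
      ultimately show ?thesis
        using eventually_ge_at_top[of 1]
      proof eventually_elim
        case (elim n)
        have "(4::real) ^ m n = exp (real (m n) * ln 4)"
          by (simp add: exp_of_nat_mult)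
        also have "\<dots> \<le> exp (sqrt (real n) * ln 4)"
          using mle by simp
        finally have "real ((n + 1) * (s n * 4 ^ m n)) \<le>
            (real n + 1) * ((exp (real n * R') + 1) * exp (sqrt (real n) * ln 4))"
          unfolding of_nat_mult of_nat_add of_nat_power
          using sle[of n] by (intro mult_mono) auto
        also have "\<dots> \<le> exp (real n * r)" by (rule elim(2))
        also have "\<dots> \<le> real (M n)"
        proof -
          have "real n * r \<le> ln (real (M n))" using elim(1,3) by (simp add: field_simps)
          then show ?thesis using M1[OF elim(3)] by (subst (asm) ln_ge_iff) auto
        qed
        finally show ?case using elim(3) unfolding ok_def by (simp only: of_nat_le_iff)
      qed
    qed
    define e where "e n = trans_err Y W n (M n) (\<phi> n) (\<psi> n)" for n
    \<comment> \<open>As the error is at most 1, the factor 1 + 1/n amounts to an additive 1/n,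
      which \<open>limsup_le_perturb\<close> removes.\<close>
    have e1: "e n \<le> 1" if "1 \<le> n" for n
    proof -
      have "(\<Sum>i\<in>{1..M n}. measure (W n (\<phi> n i)) (space (Yn Y n) - \<psi> n -` {i})) \<le> real (M n) * 1"
        using sum_bounded_above[of "{1..M n}" "\<lambda>i. measure (W n (\<phi> n i)) (space (Yn Y n) - \<psi> n -` {i})" 1]
          \<phi>[OF that] costset_subset_inputs[of c \<Gamma> n]
          finite_channel.measure_W_le_1[OF finite_channel.intro[OF chan], of _ n] by (simp add: subset_iff)
      then show ?thesis using M1[OF that] by (simp add: e_def trans_err_def)
    qed
    have "\<exists>N Q D. 1 \<le> N \<and> (\<forall>i\<in>{1..N}. set_pmf (Q i) \<subseteq> costset c \<Gamma> n \<and> D i \<in> sets (Yn Y n)) \<and>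
        (ok n \<longrightarrow> N = 2 ^ s n \<and> id_mu Y W n N Q D \<le> (1 + 1 / real n) * e n \<and>
          id_lambda Y W n N Q D \<le> 1 / real (m n) + (1 + 1 / real n) * e n)" if n: "1 \<le> n" for n
    proof (cases "ok n")
      case True
      have "\<exists>Q D. (\<forall>i\<in>{1..2 ^ s n}. set_pmf (Q i) \<subseteq> \<phi> n ` {1..M n} \<and> D i \<in> sets (Yn Y n))
        \<and> id_mu Y W n (2 ^ s n) Q D \<le> (1 + 1 / real n) * e n
        \<and> id_lambda Y W n (2 ^ s n) Q D \<le> 1 / real (m n) + (1 + 1 / real n) * e n"
        unfolding e_def using n M1 s1 m1 True \<phi>[OF n] \<psi>[OF n] costset_subset_inputs[of c \<Gamma> n]
        by (intro finite_channel.ident_code_from_trans_code finite_channel.intro chan) (auto simp: ok_def)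
      then obtain Q D where QD: "\<And>i. i \<in> {1..2 ^ s n} \<Longrightarrow> set_pmf (Q i) \<subseteq> \<phi> n ` {1..M n} \<and> D i \<in> sets (Yn Y n)"
        "id_mu Y W n (2 ^ s n) Q D \<le> (1 + 1 / real n) * e n"
        "id_lambda Y W n (2 ^ s n) Q D \<le> 1 / real (m n) + (1 + 1 / real n) * e n" by blast
      have "\<phi> n ` {1..M n} \<subseteq> costset c \<Gamma> n" using \<phi>[OF n] by auto
      then show ?thesis
        using QD by (intro exI[of _ "2 ^ s n"] exI[of _ Q] exI[of _ D]) fastforce
    next
      case False
      then show ?thesis
        using \<phi>[OF n, of 1] M1[OF n]
        by (intro exI[of _ 1] exI[of _ "\<lambda>_. return_pmf (\<phi> n 1)"] exI[of _ "\<lambda>_. space (Yn Y n)"]) auto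
    qed
    then obtain N Q D where code:
      "\<And>n. 1 \<le> n \<Longrightarrow> 1 \<le> N n \<and> (\<forall>i\<in>{1..N n}. set_pmf (Q n i) \<subseteq> costset c \<Gamma> n \<and> D n i \<in> sets (Yn Y n))"
      "\<And>n. ok n \<Longrightarrow> N n = 2 ^ s n \<and> id_mu Y W n (N n) (Q n) (D n) \<le> (1 + 1 / real n) * e n \<and>
          id_lambda Y W n (N n) (Q n) (D n) \<le> 1 / real (m n) + (1 + 1 / real n) * e n"
      unfolding ok_def by metis
    have err': "limsup (\<lambda>n. ereal (e n)) \<le> ereal \<epsilon>" using err by (simp add: e_def)
    have mu: "limsup (\<lambda>n. ereal (id_mu Y W n (N n) (Q n) (D n))) \<le> ereal \<epsilon>"
    proof (rule limsup_le_perturb[OF _ _ err'])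
      show "\<forall>\<^sub>F n in sequentially. id_mu Y W n (N n) (Q n) (D n) \<le> e n + 1 / real n"
        using ev
      proof eventually_elim
        case (elim n)
        then have n: "1 \<le> n" by (simp add: ok_def)
        have "(1 + 1 / real n) * e n \<le> e n + 1 / real n"
          using e1[OF n] n by (simp add: field_simps)
        then show ?case using code(2)[OF elim] by linarith
      qed
    qed real_asymp
    have lam: "limsup (\<lambda>n. ereal (id_lambda Y W n (N n) (Q n) (D n))) \<le> ereal \<epsilon>"
    proof (rule limsup_le_perturb[OF _ _ err'])
      show "\<forall>\<^sub>F n in sequentially. id_lambda Y W n (N n) (Q n) (D n) \<le> e n + (1 / real n + 1 / real (m n))"
        using ev
      proof eventually_elim
        case (elim n)
        then have n: "1 \<le> n" by (simp add: ok_def)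
        have "(1 + 1 / real n) * e n \<le> e n + 1 / real n"
          using e1[OF n] n by (simp add: field_simps)
        then show ?case using code(2)[OF elim] by linarith
      qed
      show "(\<lambda>n. 1 / real n + 1 / real (m n)) \<longlonglongrightarrow> 0"
        unfolding m_def by real_asymp
    qed
    have "ereal R' \<le> liminf (\<lambda>n. ereal (ln (ln (real (N n))) / real n))"
    proof (rule liminf_ge_lim)
      show "\<forall>\<^sub>F n in sequentially. R' + ln (ln 2) / real n \<le> ln (ln (real (N n))) / real n"
        using ev
      proof eventually_elim
        case (elim n)
        then have n: "1 \<le> n" by (simp add: ok_def)
        have "ln (ln (real (N n))) = ln (real (s n)) + ln (ln 2)"
          using code(2)[OF elim] s1[of n] by (simp add: ln_realpow ln_mult)
        moreover have "real n * R' \<le> ln (real (s n))"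
          using sge[of n] s1[of n] by (subst ln_ge_iff) auto
        ultimately show ?case using n by (simp add: field_simps)
      qed
      show "(\<lambda>n. R' + ln (ln 2) / real n) \<longlonglongrightarrow> R'" by real_asymp
    qed
    moreover have "limsup (\<lambda>n. ereal (id_mu Y W n (N n) (Q n) (D n))) \<le> ereal \<mu>"
      using mu le(1) by (meson ereal_less_eq(3) order_trans)
    moreover have "limsup (\<lambda>n. ereal (id_lambda Y W n (N n) (Q n) (D n))) \<le> ereal lam"
      using lam le(2) by (meson ereal_less_eq(3) order_trans)
    ultimately show ?thesis
      unfolding ident_achievable_def using code(1) by blast
  qed
qed

lemma C_s_le_D_id:
  fixes W :: "nat \<Rightarrow> 'a::finite list \<Rightarrow> (nat \<Rightarrow> 'b) measure"
  assumes "general_channel Y W" "0 \<le> \<mu>" "0 \<le> lam" "\<epsilon> \<le> \<mu>" "\<epsilon> \<le> lam"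
  shows "C_s Y W c \<Gamma> \<epsilon> \<le> D_id Y W c \<Gamma> \<mu> lam"
  unfolding C_s_def
proof (rule Sup_least, safe, rule ereal_le_if_all_less)
  fix R R' assume "trans_achievable Y W c \<Gamma> \<epsilon> R" "R' < R"
  then have "ident_achievable Y W c \<Gamma> \<mu> lam R'"
    using trans_achievable_imp_ident_achievable[OF assms] by blast
  then show "ereal R' \<le> D_id Y W c \<Gamma> \<mu> lam"
    unfolding D_id_def by (intro Sup_upper) auto
qed

section \<open>From identification to resolvability\<close>

lemma sum_powers_le: "(\<Sum>i\<le>K. a ^ i) \<le> (a + 1 :: nat) ^ K"
proof (induction K)
  case (Suc K)
  have "a ^ Suc K \<le> a * (a + 1) ^ K" by (simp add: power_mono)
  with Suc have "(\<Sum>i\<le>Suc K. a ^ i) \<le> (a + 1) ^ K + a * (a + 1) ^ K"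
    unfolding sum.atMost_Suc by (rule add_mono)
  then show ?case by (simp add: algebra_simps)
qed simp

lemma power_add_one_le: "1 \<le> n \<Longrightarrow> a ^ n + 1 \<le> (a + 1 :: nat) ^ n"
proof (induction n rule: dec_induct)
  case (step n)
  have "a * (a ^ n + 1) \<le> a * (a + 1) ^ n" using step by (intro mult_left_mono) auto
  with step show ?case by (simp add: algebra_simps)
qed simp

lemma abs_measure_diff_le_var_dist:
  assumes "prob_space P" "prob_space P'" "B \<in> sets P"
  shows "\<bar>measure P B - measure P' B\<bar> \<le> var_dist P P' / 2"
proof -
  interpret P: prob_space P by fact
  interpret P': prob_space P' by fact
  have "\<bar>measure P C - measure P' C\<bar> \<le> 1" for C
    using P.prob_le_1[of C] P'.prob_le_1[of C] measure_nonneg[of P C] measure_nonneg[of P' C]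
    by linarith
  then have "bdd_above ((\<lambda>C. \<bar>measure P C - measure P' C\<bar>) ` sets P)"
    by (intro bdd_aboveI2)
  from cSUP_upper[OF assms(3) this] show ?thesis
    by (simp add: var_dist_def)
qed

text \<open>If every input distribution of an identification code is resolvable with at most \<open>K\<close>
  points, then distinct distributions need distinct lists of points.\<close>
lemma (in finite_channel) ident_code_size_le:
  assumes A: "A \<subseteq> inputs n"
    and Q: "\<And>i. i \<in> {1..N} \<Longrightarrow> set_pmf (Q i) \<subseteq> inputs n"
    and D: "\<And>i. i \<in> {1..N} \<Longrightarrow> D i \<in> sets (Yn Y n)"
    and small: "id_mu Y W n N Q D + id_lambda Y W n N Q D + \<delta> < 1"
    and res: "\<And>i. i \<in> {1..N} \<Longrightarrow> \<exists>M \<phi>. 1 \<le> M \<and> M \<le> K \<and> \<phi> ` {1..M} \<subseteq> A \<and>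
      var_dist (outdist Y W n (Q i)) (outdist Y W n (map_pmf \<phi> (pmf_of_set {1..M}))) \<le> \<delta>"
  shows "N \<le> (card (inputs n :: 'a list set) + 1) ^ K"
proof -
  let ?I = "inputs n :: 'a list set"
  obtain M \<phi> where M: "\<And>i. i \<in> {1..N} \<Longrightarrow> 1 \<le> M i \<and> M i \<le> K" "\<And>i. i \<in> {1..N} \<Longrightarrow> \<phi> i ` {1..M i} \<subseteq> A"
    "\<And>i. i \<in> {1..N} \<Longrightarrow>
      var_dist (outdist Y W n (Q i)) (outdist Y W n (map_pmf (\<phi> i) (pmf_of_set {1..M i}))) \<le> \<delta>"
    using res by metis
  define U where "U i = map_pmf (\<phi> i) (pmf_of_set {1..M i})" for i
  \<comment> \<open>The length of the list records the number of points, so the list determines the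
    input distribution \<open>U i\<close>.\<close>
  define L where "L i = map (\<phi> i) [1..<Suc (M i)]" for i
  have suppU: "set_pmf (U i) \<subseteq> inputs n" if "i \<in> {1..N}" for i
    using M(1)[OF that] M(2)[OF that] A by (auto simp: U_def)
  have close: "\<bar>measure (outdist Y W n (Q i)) B - measure (outdist Y W n (U i)) B\<bar> \<le> \<delta> / 2"
    if "i \<in> {1..N}" "B \<in> sets (Yn Y n)" for i B
    using abs_measure_diff_le_var_dist[of "outdist Y W n (Q i)" "outdist Y W n (U i)" B]
      M(3)[OF that(1)] that(2) prob_space_outdist[OF Q[OF that(1)]] prob_space_outdist[OF suppU[OF that(1)]]
    unfolding U_def by simp
  have "inj_on L {1..N}"
  proof (rule inj_onI, rule ccontr)
    fix i j assume i: "i \<in> {1..N}" and j: "j \<in> {1..N}" and L: "L i = L j" and ij: "i \<noteq> j"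
    have "length (L i) = length (L j)" using L by simp
    then have Mij: "M i = M j" unfolding L_def length_map length_upt by simp
    have UU: "U i = U j"
      unfolding U_def Mij
    proof (rule map_pmf_cong[OF refl])
      fix k assume "k \<in> set_pmf (pmf_of_set {1..M j})"
      then have "k \<in> {1..M j}" using M(1)[OF j] by auto
      then show "\<phi> i k = \<phi> j k"
        using L unfolding L_def Mij by auto
    qed
    \<comment> \<open>Both output laws are within \<delta>/2 of the common law of \<open>U i\<close>
      and \<open>U j\<close>. But \<open>D i\<close> has probability at least 1 -
      \<open>id_mu\<close> under message i and at most \<open>id_lambda\<close> under message
      j.\<close>
    have "\<bar>measure (outdist Y W n (Q i)) (D i) - measure (outdist Y W n (Q j)) (D i)\<bar> \<le> \<delta>"
      using close[OF i D[OF i], unfolded UU] close[OF j D[OF i]] by linarith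
    moreover have "1 - measure (outdist Y W n (Q i)) (D i) \<le> id_mu Y W n N Q D"
    proof -
      have "1 - measure (outdist Y W n (Q i)) (D i) =
          measure (outdist Y W n (Q i)) (space (Yn Y n) - D i)"
        using prob_space.prob_compl[OF prob_space_outdist[OF Q[OF i]], of "D i"] D[OF i] by simp
      also have "\<dots> \<le> id_mu Y W n N Q D"
        unfolding id_mu_def using i by (intro Max_ge) auto
      finally show ?thesis .
    qed
    moreover have "measure (outdist Y W n (Q j)) (D i) \<le> id_lambda Y W n N Q D"
      unfolding id_lambda_def using i j ij finite_id_lambda_set[of Y W n Q D N]
      by (intro Max_ge) auto
    ultimately show False using small by linarith
  qed
  then have "N = card (L ` {1..N})" by (simp add: card_image)
  also have "\<dots> \<le> card {xs. set xs \<subseteq> ?I \<and> length xs \<le> K}"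
  proof (intro card_mono finite_lists_length_le)
    show "L ` {1..N} \<subseteq> {xs. set xs \<subseteq> ?I \<and> length xs \<le> K}"
    proof
      fix xs assume "xs \<in> L ` {1..N}"
      then obtain i where i: "i \<in> {1..N}" and xs: "xs = L i" by auto
      have "set [1..<Suc (M i)] = {1..M i}" by auto
      then show "xs \<in> {xs. set xs \<subseteq> ?I \<and> length xs \<le> K}"
        using M(1)[OF i] M(2)[OF i] A unfolding xs L_def by auto
    qed
  qed simp
  also have "\<dots> = (\<Sum>i\<le>K. card ?I ^ i)"
    by (rule card_lists_length_le) simp
  also have "\<dots> \<le> (card ?I + 1) ^ K" by (rule sum_powers_le)
  finally show ?thesis .
qed

lemma ident_achievable_le_resolv_achievable:
  fixes W :: "nat \<Rightarrow> 'a::finite list \<Rightarrow> (nat \<Rightarrow> 'b) measure"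
  assumes chan: "general_channel Y W" and \<delta>: "\<delta> < 1 - \<mu> - lam"
    and ident: "ident_achievable Y W c \<Gamma> \<mu> lam R"
    and resolv: "resolv_achievable Y W c \<Gamma> \<delta> R'"
  shows "R \<le> R'"
proof (rule ccontr)
  assume "\<not> R \<le> R'"
  then have RR: "R' < R" by simp
  obtain N Q D where N1: "\<And>n. 1 \<le> n \<Longrightarrow> 1 \<le> N n"
    and Q: "\<And>n i. 1 \<le> n \<Longrightarrow> i \<in> {1..N n} \<Longrightarrow> set_pmf (Q n i) \<subseteq> costset c \<Gamma> n"
    and D: "\<And>n i. 1 \<le> n \<Longrightarrow> i \<in> {1..N n} \<Longrightarrow> D n i \<in> sets (Yn Y n)"
    and mu: "limsup (\<lambda>n. ereal (id_mu Y W n (N n) (Q n) (D n))) \<le> ereal \<mu>"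
    and lam: "limsup (\<lambda>n. ereal (id_lambda Y W n (N n) (Q n) (D n))) \<le> ereal lam"
    and rate: "ereal R \<le> liminf (\<lambda>n. ereal (ln (ln (real (N n))) / real n))"
    using ident unfolding ident_achievable_def by blast
  \<comment> \<open>A codebook has at least one point, so its rate is nonnegative. Hence r' below is
    positive, which keeps the lower bound on ln (ln N) clear of the convention
    \<open>ln 0 = 0\<close>.\<close>
  have "0 \<le> R'"
  proof -
    have "(\<lambda>n. Q n 1) \<in> S_Gamma c \<Gamma>"
      using Q N1 by (auto simp: S_Gamma_def)
    then obtain M where M: "\<And>n. 1 \<le> n \<Longrightarrow> 1 \<le> M n"
      "limsup (\<lambda>n. ereal (ln (real (M n)) / real n)) \<le> ereal R'"
      using resolv unfolding resolv_achievable_def resolv_achievable_for_def by blast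
    have "\<forall>\<^sub>F n in sequentially. 0 \<le> ereal (ln (real (M n)) / real n)"
      using eventually_ge_at_top[of 1] by eventually_elim (use M(1) in auto)
    then have "0 \<le> limsup (\<lambda>n. ereal (ln (real (M n)) / real n))"
      by (intro le_Limsup) auto
    from order_trans[OF this M(2)] show ?thesis by simp
  qed
  \<comment> \<open>Codebooks of rate R' have at most exp (n r) points for large n, while ln N
    exceeds exp (n r'). The gap between r and r' absorbs the factor n ln (|X| + 1) from counting
    lists.\<close>
  define r where "r = (2 * R' + R) / 3"
  define r' where "r' = (R' + 2 * R) / 3"
  have r: "R' < r" "r < r'" "r' < R" "0 < r'" "0 < r"
    using RR \<open>0 \<le> R'\<close> by (auto simp: r_def r'_def)
  \<comment> \<open>Three of the four parts are spent on \<mu>, \<open>lam\<close> and \<delta>; the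
    fourth keeps the sum strictly below 1.\<close>
  define \<eta> where "\<eta> = (1 - \<mu> - lam - \<delta>) / 4"
  have \<eta>: "0 < \<eta>" using \<delta> by (simp add: \<eta>_def)
  define K where "K n = nat \<lfloor>exp (real n * r)\<rfloor>" for n
  define bad where "bad n i \<longleftrightarrow> (\<forall>M \<phi>. 1 \<le> M \<and> M \<le> K n \<and> \<phi> ` {1..M} \<subseteq> costset c \<Gamma> n \<longrightarrow>
     \<delta> + \<eta> < var_dist (outdist Y W n (Q n i)) (outdist Y W n (map_pmf \<phi> (pmf_of_set {1..M}))))"
    for n and i :: nat
  have ev_bad: "\<forall>\<^sub>F n in sequentially. \<exists>i\<in>{1..N n}. bad n i"
  proof -
    have "\<forall>\<^sub>F n in sequentially. ereal (id_mu Y W n (N n) (Q n) (D n)) < ereal (\<mu> + \<eta>)"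
      using mu[unfolded Limsup_le_iff, rule_format, of "ereal (\<mu> + \<eta>)"] \<eta> by simp
    moreover have "\<forall>\<^sub>F n in sequentially. ereal (id_lambda Y W n (N n) (Q n) (D n)) < ereal (lam + \<eta>)"
      using lam[unfolded Limsup_le_iff, rule_format, of "ereal (lam + \<eta>)"] \<eta> by simp
    moreover have "\<forall>\<^sub>F n in sequentially. ereal r' < ereal (ln (ln (real (N n))) / real n)"
    proof (rule less_LiminfD)
      have "ereal r' < ereal R" using r(3) by simp
      then show "ereal r' < liminf (\<lambda>n. ereal (ln (ln (real (N n))) / real n))"
        using rate by (rule order_less_le_trans)
    qed
    moreover have "\<forall>\<^sub>F n in sequentially. exp (real n * r) * (real n * ln (real CARD('a) + 1)) < exp (real n * r')"
    proof -
      define l where "l = ln (real CARD('a) + 1)"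
      have "0 < l" by (simp add: l_def)
      have "(\<lambda>n. exp (real n * r) * (real n * l) / exp (real n * r')) \<longlonglongrightarrow> 0"
        using r(2,4,5) \<open>0 < l\<close> by real_asymp
      then have "\<forall>\<^sub>F n in sequentially. exp (real n * r) * (real n * l) / exp (real n * r') < 1"
        by (rule order_tendstoD) simp
      then show ?thesis unfolding l_def by eventually_elim (simp add: field_simps)
    qed
    ultimately show ?thesis
      using eventually_ge_at_top[of 1]
    proof eventually_elim
      case (elim n)
      note n = elim(5)
      interpret finite_channel Y W n by (rule finite_channel.intro[OF chan])
      have sub: "costset c \<Gamma> n \<subseteq> inputs n" by (rule costset_subset_inputs)
      show ?case
      proof (rule ccontr)
        assume "\<not> ?case"
        then have nb: "\<And>i. i \<in> {1..N n} \<Longrightarrow> \<exists>M \<phi>. 1 \<le> M \<and> M \<le> K n \<and> \<phi> ` {1..M} \<subseteq> costset c \<Gamma> n \<and>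
          var_dist (outdist Y W n (Q n i)) (outdist Y W n (map_pmf \<phi> (pmf_of_set {1..M}))) \<le> \<delta> + \<eta>"
          unfolding bad_def by (meson not_le)
        have "id_mu Y W n (N n) (Q n) (D n) + id_lambda Y W n (N n) (Q n) (D n) + (\<delta> + \<eta>) <
            (\<mu> + \<eta>) + (lam + \<eta>) + (\<delta> + \<eta>)"
          using elim(1,2) by simp
        also have "\<dots> < 1" using \<delta> by (simp add: \<eta>_def field_simps)
        finally have "N n \<le> (card (inputs n :: 'a list set) + 1) ^ K n"
          using ident_code_size_le[where N = "N n" and Q = "Q n" and D = "D n", OF sub order_trans[OF Q[OF n] sub] D[OF n] _ nb]
          by blast
        also have "\<dots> \<le> ((CARD('a) + 1) ^ n) ^ K n"
        proof (intro power_mono)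
          show "card (inputs n :: 'a list set) + 1 \<le> (CARD('a) + 1) ^ n"
            unfolding card_inputs using n by (rule power_add_one_le)
        qed simp
        finally have "real (N n) \<le> (real CARD('a) + 1) ^ (n * K n)"
          by (metis (mono_tags, lifting) of_nat_1 of_nat_add of_nat_le_iff of_nat_power power_mult)
        moreover have N0: "0 < real (N n)" using N1[OF n] by simp
        ultimately have "ln (real (N n)) \<le> real (n * K n) * ln (real CARD('a) + 1)"
          by (metis ln_le_cancel_iff ln_realpow order_less_le_trans of_nat_0_le_iff add_nonneg_pos zero_less_one)
        also have "\<dots> = real (K n) * (real n * ln (real CARD('a) + 1))"
          by simp
        also have "\<dots> \<le> exp (real n * r) * (real n * ln (real CARD('a) + 1))"
          by (intro mult_right_mono) (auto simp: K_def)
        also have "\<dots> < exp (real n * r')" by (rule elim(4))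
        also have "\<dots> < ln (real (N n))"
        proof -
          \<comment> \<open>Since n r' is nonnegative, this excludes a single message, for which ln
            (ln 1) = 0, and so the logarithm may be inverted.\<close>
          have gt: "real n * r' < ln (ln (real (N n)))"
            using elim(3) n by (simp add: field_simps)
          moreover have "0 \<le> real n * r'" using r(4) by simp
          ultimately have "ln (real (N n)) \<noteq> 0" by auto
          moreover have "0 \<le> ln (real (N n))" using N1[OF n] by simp
          ultimately have "0 < ln (real (N n))" by simp
          with gt show ?thesis by (metis exp_less_cancel_iff exp_ln)
        qed
        finally show False .
      qed
    qed
  qed
  \<comment> \<open>Message 1 is a filler where no message is bad: the process must be admissible at
    every block length from 1 on.\<close>
  define i where "i n = (if \<exists>i\<in>{1..N n}. bad n i then SOME i. i \<in> {1..N n} \<and> bad n i else 1)" for n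
  have bad: "i n \<in> {1..N n} \<and> bad n (i n)" if "\<exists>i\<in>{1..N n}. bad n i" for n
    unfolding i_def using that by (simp only: if_True) (rule someI_ex, blast)
  have "i n \<in> {1..N n}" if "1 \<le> n" for n
  proof (cases "\<exists>i\<in>{1..N n}. bad n i")
    case True
    then show ?thesis using bad by blast
  next
    case False
    then have "i n = 1" by (simp only: i_def if_False)
    then show ?thesis using N1[OF that] by simp
  qed
  then have "(\<lambda>n. Q n (i n)) \<in> S_Gamma c \<Gamma>"
    unfolding S_Gamma_def mem_Collect_eq by (intro allI impI Q)
  then have "resolv_achievable_for Y W c \<Gamma> \<delta> R' (\<lambda>n. Q n (i n))"
    using resolv unfolding resolv_achievable_def by (rule bspec[rotated])
  then obtain M \<phi> where M1: "\<forall>n\<ge>1. 1 \<le> M n \<and> (\<forall>k\<in>{1..M n}. \<phi> n k \<in> costset c \<Gamma> n)"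
    and M: "limsup (\<lambda>n. ereal (var_dist (outdist Y W n (Q n (i n)))
          (outdist Y W n (map_pmf (\<phi> n) (pmf_of_set {1..M n}))))) \<le> ereal \<delta>"
      "limsup (\<lambda>n. ereal (ln (real (M n)) / real n)) \<le> ereal R'"
    unfolding resolv_achievable_for_def by (elim exE conjE)
  have "\<forall>\<^sub>F n in sequentially. ereal (var_dist (outdist Y W n (Q n (i n)))
          (outdist Y W n (map_pmf (\<phi> n) (pmf_of_set {1..M n})))) < ereal (\<delta> + \<eta>)"
    using M(1)[unfolded Limsup_le_iff, rule_format, of "ereal (\<delta> + \<eta>)"] \<eta> by simp
  moreover have "\<forall>\<^sub>F n in sequentially. ereal (ln (real (M n)) / real n) < ereal r"
    using M(2)[unfolded Limsup_le_iff, rule_format, of "ereal r"] r by simp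
  ultimately have "\<forall>\<^sub>F n in sequentially. False"
    using ev_bad eventually_ge_at_top[of 1]
  proof eventually_elim
    case (elim n)
    have "ln (real (M n)) < real n * r" using elim(2,4) by (simp add: field_simps)
    then have "real (M n) < exp (real n * r)"
      using M1 elim(4) 
      by (subst (asm) exp_less_cancel_iff[symmetric], subst (asm) exp_ln) auto
    then have "M n \<le> K n" by (simp add: K_def le_nat_floor)
    moreover have "\<phi> n ` {1..M n} \<subseteq> costset c \<Gamma> n" using M1 elim(4) by auto
    ultimately have "\<delta> + \<eta> < var_dist (outdist Y W n (Q n (i n)))
          (outdist Y W n (map_pmf (\<phi> n) (pmf_of_set {1..M n})))"
      using bad[OF elim(3)] M1 elim(4) unfolding bad_def by blast
    then show False using elim(1) by simp
  qed
  then show False by simp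
qed

lemma D_id_le_S_res:
  fixes W :: "nat \<Rightarrow> 'a::finite list \<Rightarrow> (nat \<Rightarrow> 'b) measure"
  assumes "general_channel Y W" "\<delta> < 1 - \<mu> - lam"
  shows "D_id Y W c \<Gamma> \<mu> lam \<le> S_res Y W c \<Gamma> \<delta>"
  unfolding D_id_def S_res_def
  using ident_achievable_le_resolv_achievable[OF assms]
  by (intro Sup_least Inf_greatest) auto

section \<open>Soft covering\<close>

context prob_space
begin

text \<open>Boundedness on the whole type is stable under arithmetic and gives integrability, so the
  side conditions of the second moment computation follow by rules alone.\<close>

definition bounded_rv :: "('a \<Rightarrow> real) \<Rightarrow> bool" where
  "bounded_rv f \<longleftrightarrow> f \<in> borel_measurable M \<and> bounded (range f)"

lemma bounded_rv_integrable:
  assumes "bounded_rv f"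
  shows "integrable M f"
proof -
  obtain a where "\<And>y. \<bar>f y\<bar> \<le> a"
    using assms unfolding bounded_rv_def bounded_iff by auto
  with assms show ?thesis
    by (intro integrable_const_bound[where B = a]) (auto simp: bounded_rv_def)
qed

lemma bounded_rv_const: "bounded_rv (\<lambda>_. a)"
  by (auto simp: bounded_rv_def)

lemma bounded_rv_add: "bounded_rv f \<Longrightarrow> bounded_rv g \<Longrightarrow> bounded_rv (\<lambda>y. f y + g y)"
  unfolding bounded_rv_def by (auto intro: bounded_plus_comp)

lemma bounded_rv_diff: "bounded_rv f \<Longrightarrow> bounded_rv g \<Longrightarrow> bounded_rv (\<lambda>y. f y - g y)"
  unfolding bounded_rv_def by (auto intro: bounded_minus_comp)

lemma bounded_rv_mult:
  assumes "bounded_rv f" "bounded_rv g"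
  shows "bounded_rv (\<lambda>y. f y * g y)"
proof -
  obtain a b where ab: "\<And>y. \<bar>f y\<bar> \<le> a" "\<And>y. \<bar>g y\<bar> \<le> b"
    using assms unfolding bounded_rv_def bounded_iff by auto
  have "\<bar>f y * g y\<bar> \<le> a * b" for y
    unfolding abs_mult using ab[of y] by (intro mult_mono) auto
  with assms show ?thesis
    by (auto simp: bounded_rv_def bounded_iff)
qed

lemma bounded_rv_sum: "(\<And>i. i \<in> I \<Longrightarrow> bounded_rv (f i)) \<Longrightarrow> bounded_rv (\<lambda>y. \<Sum>i\<in>I. f i y)"
  by (induction I rule: infinite_finite_induct) (auto intro: bounded_rv_const bounded_rv_add)

lemma bounded_rv_indicator: "B \<in> events \<Longrightarrow> bounded_rv (indicator B)"
  by (auto simp: bounded_rv_def bounded_iff indicator_def intro!: exI[of _ 1])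

lemmas bounded_rv_intros =
  bounded_rv_const bounded_rv_add bounded_rv_diff bounded_rv_mult bounded_rv_sum bounded_rv_indicator

text \<open>The variance of \<open>f\<close> times the indicator is nonnegative. This turns an L2
  estimate of a deviation into a bound that does not depend on \<open>B\<close>, as the variational
  distance demands.\<close>

lemma abs_integral_indicator_le_sqrt:
  assumes f: "bounded_rv f" and B: "B \<in> events"
  shows "\<bar>\<integral>y. f y * indicator B y \<partial>M\<bar> \<le> sqrt (\<integral>y. f y * f y \<partial>M)"
proof (rule real_le_rsqrt)
  let ?h = "\<lambda>y. f y * indicator B y"
  have h: "bounded_rv ?h" using f B by (intro bounded_rv_intros)
  have "0 \<le> variance ?h" by (rule variance_positive)
  also have "variance ?h = (\<integral>y. (?h y)\<^sup>2 \<partial>M) - (\<integral>y. ?h y \<partial>M)\<^sup>2"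
    using h bounded_rv_mult[OF h h] by (intro variance_eq bounded_rv_integrable) (auto simp: power2_eq_square)
  finally have "(\<integral>y. ?h y \<partial>M)\<^sup>2 \<le> (\<integral>y. ?h y * ?h y \<partial>M)" by (simp add: power2_eq_square)
  also have "\<dots> \<le> (\<integral>y. f y * f y \<partial>M)"
    using bounded_rv_mult[OF h h] bounded_rv_mult[OF f f]
    by (intro integral_mono bounded_rv_integrable) (auto simp: indicator_def)
  finally show "\<bar>\<integral>y. ?h y \<partial>M\<bar>\<^sup>2 \<le> (\<integral>y. f y * f y \<partial>M)" by simp
qed

end

text \<open>The cross term averages to 0, and the variance of \<open>g\<close> is at most its second
  moment, hence at most \<theta> m as \<open>g\<close> lies between 0 and \<theta>. In the
  application \<open>s\<close> is the deviation accumulated by the points already chosen, and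
  \<open>x\<close> is the next one.\<close>

lemma average_square_le:
  fixes q g :: "'x \<Rightarrow> real"
  assumes q: "(\<Sum>x\<in>I. q x) = 1" "\<And>x. x \<in> I \<Longrightarrow> 0 \<le> q x"
    and g: "\<And>x. x \<in> I \<Longrightarrow> 0 \<le> g x \<and> g x \<le> \<theta>" and m: "m = (\<Sum>x\<in>I. q x * g x)"
  shows "(\<Sum>x\<in>I. q x * ((s + (g x - m)) * (s + (g x - m)))) \<le> s * s + \<theta> * m"
proof -
  have "(\<Sum>x\<in>I. q x * ((s + (g x - m)) * (s + (g x - m)))) =
      (\<Sum>x\<in>I. q x * ((s - m) * (s - m)) + 2 * (s - m) * (q x * g x) + q x * (g x * g x))"
    by (intro sum.cong refl) (simp add: algebra_simps)
  also have "\<dots> = (s - m) * (s - m) + 2 * (s - m) * m + (\<Sum>x\<in>I. q x * (g x * g x))"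
    by (simp add: sum.distrib m q(1) flip: sum_distrib_left sum_distrib_right)
  also have "(\<Sum>x\<in>I. q x * (g x * g x)) \<le> (\<Sum>x\<in>I. q x * (\<theta> * g x))"
    using q g by (intro sum_mono mult_left_mono mult_right_mono) auto
  also have "(\<Sum>x\<in>I. q x * (\<theta> * g x)) = \<theta> * m"
    by (simp add: m sum_distrib_left mult_ac)
  finally show ?thesis by (simp add: algebra_simps) (smt (verit) zero_le_square)
qed

text \<open>Derandomised second moment method: the points are chosen one after another so that the
  potential does not grow more than it does on average for independent random points.\<close>
lemma exists_small_deviation:
  assumes P: "prob_space P" and supp: "set_pmf Q \<subseteq> inputs n"
    and gm: "\<And>x. g x \<in> borel_measurable P" and g: "\<And>x y. 0 \<le> g x y \<and> g x y \<le> \<theta>"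
    and int: "\<And>x. x \<in> set_pmf Q \<Longrightarrow> (\<integral>y. g x y \<partial>P) \<le> 1"
    and gbar: "gbar = (\<lambda>y. \<Sum>x\<in>inputs n. pmf Q (x :: 'a::finite list) * g x y)"
  shows "\<exists>\<phi>. (\<forall>i. \<phi> i \<in> set_pmf Q) \<and>
    (\<integral>y. (\<Sum>i<k. g (\<phi> i) y - gbar y) * (\<Sum>i<k. g (\<phi> i) y - gbar y) \<partial>P) + C * (\<Sum>i<k. H (\<phi> i))
      \<le> real k * (\<theta> + C * (\<Sum>x\<in>inputs n. pmf Q x * H x))"
proof (induction k)
  case 0
  obtain x where "x \<in> set_pmf Q" using set_pmf_not_empty by fastforce
  then show ?case by (intro exI[of _ "\<lambda>_. x"]) simp
next
  case (Suc k)
  interpret prob_space P by (rule P)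
  let ?h = "\<Sum>x\<in>inputs n. pmf Q x * H x"
  from Suc obtain \<phi> where \<phi>: "\<And>i. \<phi> i \<in> set_pmf Q"
    and IH: "(\<integral>y. (\<Sum>i<k. g (\<phi> i) y - gbar y) * (\<Sum>i<k. g (\<phi> i) y - gbar y) \<partial>P) + C * (\<Sum>i<k. H (\<phi> i))
      \<le> real k * (\<theta> + C * ?h)" by blast
  define S where "S y = (\<Sum>i<k. g (\<phi> i) y - gbar y)" for y
  have bg: "bounded_rv (g x)" for x
    unfolding bounded_rv_def bounded_iff using gm g by (auto intro!: exI[of _ \<theta>])
  have bgbar: "bounded_rv gbar"
    unfolding gbar by (intro bounded_rv_intros bg)
  have bS: "bounded_rv S"
    unfolding S_def by (intro bounded_rv_intros bg bgbar)
  \<comment> \<open>The potential if \<open>x\<close> comes next, apart from the penalties of the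
    earlier points. The penalty \<open>H\<close> lets the same choices control a second
    quantity.\<close>
  define F where "F x = (\<integral>y. (S y + (g x y - gbar y)) * (S y + (g x y - gbar y)) \<partial>P) + C * H x" for x
  have "(\<Sum>x\<in>inputs n. pmf Q x * F x) =
      (\<integral>y. (\<Sum>x\<in>inputs n. pmf Q x * ((S y + (g x y - gbar y)) * (S y + (g x y - gbar y)))) \<partial>P) + C * ?h"
  proof -
    let ?sq = "\<lambda>x y. (S y + (g x y - gbar y)) * (S y + (g x y - gbar y))"
    have "(\<Sum>x\<in>inputs n. pmf Q x * F x) = (\<Sum>x\<in>inputs n. pmf Q x * (\<integral>y. ?sq x y \<partial>P)) + C * ?h"
      unfolding F_def distrib_left sum.distrib sum_distrib_left[of C] mult.left_commute[of C] ..
    also have "(\<Sum>x\<in>inputs n. pmf Q x * (\<integral>y. ?sq x y \<partial>P)) = (\<Sum>x\<in>inputs n. (\<integral>y. pmf Q x * ?sq x y \<partial>P))"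
      by simp
    also have "\<dots> = (\<integral>y. (\<Sum>x\<in>inputs n. pmf Q x * ?sq x y) \<partial>P)"
      by (intro Bochner_Integration.integral_sum[symmetric] bounded_rv_integrable bounded_rv_intros bS bg bgbar)
    finally show ?thesis .
  qed
  also have "(\<integral>y. (\<Sum>x\<in>inputs n. pmf Q x * ((S y + (g x y - gbar y)) * (S y + (g x y - gbar y)))) \<partial>P) \<le>
      (\<integral>y. S y * S y + \<theta> * gbar y \<partial>P)"
    using sum_pmf_inputs[OF supp] g
    by (intro integral_mono bounded_rv_integrable bounded_rv_intros bS bg bgbar average_square_le)
      (auto simp: gbar)
  also have "\<dots> = (\<integral>y. S y * S y \<partial>P) + \<theta> * (\<Sum>x\<in>inputs n. pmf Q x * (\<integral>y. g x y \<partial>P))"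
  proof -
    have "(\<integral>y. S y * S y + \<theta> * gbar y \<partial>P) = (\<integral>y. S y * S y \<partial>P) + \<theta> * (\<integral>y. gbar y \<partial>P)"
      by (subst Bochner_Integration.integral_add)
        (auto intro!: bounded_rv_integrable bounded_rv_intros bS bgbar)
    also have "(\<integral>y. gbar y \<partial>P) = (\<Sum>x\<in>inputs n. pmf Q x * (\<integral>y. g x y \<partial>P))"
      unfolding gbar by (subst Bochner_Integration.integral_sum)
        (auto intro!: bounded_rv_integrable bounded_rv_intros bg)
    finally show ?thesis .
  qed
  also have "\<theta> * (\<Sum>x\<in>inputs n. pmf Q x * (\<integral>y. g x y \<partial>P)) \<le> \<theta> * 1"
  proof (rule mult_left_mono)
    have "pmf Q x * (\<integral>y. g x y \<partial>P) \<le> pmf Q x * 1" for x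
    proof (cases "x \<in> set_pmf Q")
      case True
      then show ?thesis using int by (intro mult_left_mono) auto
    qed (simp add: set_pmf_iff)
    then have "(\<Sum>x\<in>inputs n. pmf Q x * (\<integral>y. g x y \<partial>P)) \<le> (\<Sum>x\<in>inputs n. pmf Q x * 1)"
      by (rule sum_mono)
    then show "(\<Sum>x\<in>inputs n. pmf Q x * (\<integral>y. g x y \<partial>P)) \<le> 1"
      using sum_pmf_inputs[OF supp] by simp
    show "0 \<le> \<theta>" using g order_trans by blast
  qed
  finally have avg: "(\<Sum>x\<in>inputs n. pmf Q x * F x) \<le> (\<integral>y. S y * S y \<partial>P) + \<theta> + C * ?h"
    by simp
  obtain x where x: "x \<in> set_pmf Q" "F x \<le> (\<Sum>x\<in>inputs n. pmf Q x * F x)"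
    using exists_le_average[OF supp, of F] by blast
  define \<phi>' where "\<phi>' = \<phi>(k := x)"
  have "(\<Sum>i<Suc k. g (\<phi>' i) y - gbar y) = S y + (g x y - gbar y)" for y
    by (simp add: \<phi>'_def S_def)
  moreover have "(\<Sum>i<Suc k. H (\<phi>' i)) = (\<Sum>i<k. H (\<phi> i)) + H x"
    by (simp add: \<phi>'_def)
  ultimately have "(\<integral>y. (\<Sum>i<Suc k. g (\<phi>' i) y - gbar y) * (\<Sum>i<Suc k. g (\<phi>' i) y - gbar y) \<partial>P)
      + C * (\<Sum>i<Suc k. H (\<phi>' i)) = F x + C * (\<Sum>i<k. H (\<phi> i))"
    by (simp add: F_def algebra_simps)
  also have "\<dots> \<le> real (Suc k) * (\<theta> + C * ?h)"
    using x(2) avg IH unfolding S_def by (simp add: algebra_simps)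
  finally show ?case
    using \<phi> x(1) by (intro exI[of _ \<phi>']) (auto simp: \<phi>'_def)
qed

section \<open>Approximating an output law by a uniform codebook\<close>

context finite_channel
begin

context
  fixes Q :: "'a list pmf"
  assumes supp: "set_pmf Q \<subseteq> inputs n"
begin

text \<open>Truncation bounds the integrand, so this mass is a real integral against the output
  law.\<close>

lemma measure_W_dens_le:
  assumes x: "x \<in> set_pmf Q" and B: "B \<in> sets (Yn Y n)"
  shows "measure (W n x) (B \<inter> {y \<in> space (Yn Y n). dens Q x y \<le> \<theta>}) =
    (\<integral>y. (if dens Q x y \<le> \<theta> then dens Q x y else 0) * indicator B y \<partial>outdist Y W n Q)"
    (is "measure _ ?C = (\<integral>y. ?g y * _ \<partial>?O)")
proof -
  note [measurable] = dens_measurable[OF supp] B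
  interpret O: prob_space ?O by (rule prob_space_outdist[OF supp])
  interpret X: prob_space "W n x" using prob_space_W x supp by auto
  have bnd: "\<bar>?g y * indicator B y\<bar> \<le> \<bar>\<theta>\<bar>" for y
    using dens_nonneg[OF supp, of x y] by (auto simp: indicator_def)
  have C: "?C \<in> sets (Yn Y n)" by measurable
  have "emeasure (W n x) ?C = (\<integral>\<^sup>+y. ennreal (dens Q x y) * indicator ?C y \<partial>?O)"
    using C by (subst density_W[OF supp x], subst emeasure_density) auto
  also have "\<dots> = (\<integral>\<^sup>+y. ennreal (?g y * indicator B y) \<partial>?O)"
    by (intro nn_integral_cong) (auto simp: indicator_def)
  also have "\<dots> = ennreal (\<integral>y. ?g y * indicator B y \<partial>?O)"
  proof (rule nn_integral_eq_integral)
    show "integrable ?O (\<lambda>y. ?g y * indicator B y)"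
      using bnd by (intro O.integrable_const_bound[where B = "\<bar>\<theta>\<bar>"]) auto
  qed (use dens_nonneg[OF supp] in \<open>auto simp: indicator_def\<close>)
  finally show ?thesis
    using dens_nonneg[OF supp]
    by (simp add: X.emeasure_eq_measure integral_nonneg_AE indicator_def)
qed

text \<open>Each W^n(B|x) is a truncated integral plus a remainder of at most \<open>H x\<close>.
  The truncated parts of codebook and input differ by at most sqrt (\<theta>/M + p); the remainders
  contribute at most \<theta>/M + p for the codebook and p for the input.\<close>

lemma soft_covering:
  assumes \<theta>: "0 \<le> \<theta>" and M: "1 \<le> M"
    and p: "p = (\<Sum>x\<in>inputs n. pmf Q x * measure (W n x) {y \<in> space (Yn Y n). \<theta> < dens Q x y})"
  shows "\<exists>\<phi>. (\<forall>i. \<phi> i \<in> set_pmf Q) \<and>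
    var_dist (outdist Y W n Q) (outdist Y W n (map_pmf \<phi> (pmf_of_set {1..M})))
      \<le> 2 * (sqrt (\<theta> / real M + p) + \<theta> / real M + 2 * p)"
proof -
  let ?O = "outdist Y W n Q"
  note [measurable] = dens_measurable[OF supp]
  interpret O: prob_space ?O by (rule prob_space_outdist[OF supp])
  define g where "g x y = (if dens Q x y \<le> \<theta> then dens Q x y else 0)" for x y
  define gbar where "gbar = (\<lambda>y. \<Sum>x\<in>inputs n. pmf Q x * g x y)"
  define T where "T x = {y \<in> space (Yn Y n). \<theta> < dens Q x y}" for x
  define H where "H x = measure (W n x) (T x)" for x
  have T[measurable]: "T x \<in> sets (Yn Y n)" for x unfolding T_def by measurable
  have gm: "g x \<in> borel_measurable ?O" for x unfolding g_def by measurable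
  have g: "0 \<le> g x y \<and> g x y \<le> \<theta>" for x y
    using \<theta> dens_nonneg[OF supp, of x y] by (auto simp: g_def)
  have bg: "O.bounded_rv (g x)" for x
    unfolding O.bounded_rv_def bounded_iff using gm g by (auto intro!: exI[of _ \<theta>])
  have bgbar: "O.bounded_rv gbar"
    unfolding gbar_def by (intro O.bounded_rv_intros bg)
  have H0: "0 \<le> H x" for x by (simp add: H_def)
  have p': "p = (\<Sum>x\<in>inputs n. pmf Q x * H x)" by (simp add: p H_def T_def)
  have split: "\<exists>r. 0 \<le> r \<and> r \<le> H x \<and> measure (W n x) B = (\<integral>y. g x y * indicator B y \<partial>?O) + r"
    if x: "x \<in> set_pmf Q" and B: "B \<in> sets (Yn Y n)" for x B
  proof (intro exI conjI)
    let ?C = "B \<inter> {y \<in> space (Yn Y n). dens Q x y \<le> \<theta>}"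
    have xi: "x \<in> inputs n" using x supp by auto
    interpret X: prob_space "W n x" by (rule prob_space_W[OF xi])
    have C[measurable]: "?C \<in> sets (Yn Y n)" using B by measurable
    have BC: "B = ?C \<union> (B \<inter> T x)"
      using sets.sets_into_space[OF B] by (auto simp: T_def)
    have "measure (W n x) B = measure (W n x) ?C + measure (W n x) (B \<inter> T x)"
      using B C xi by (subst BC, intro X.finite_measure_Union) (auto simp: sets_W T_def)
    then show "measure (W n x) B = (\<integral>y. g x y * indicator B y \<partial>?O) + measure (W n x) (B \<inter> T x)"
      using measure_W_dens_le[OF x B, of \<theta>] by (simp add: g_def)
    show "measure (W n x) (B \<inter> T x) \<le> H x"
      unfolding H_def using xi by (intro measure_W_mono) auto
  qed simp
  have int: "(\<integral>y. g x y \<partial>?O) \<le> 1" if x: "x \<in> set_pmf Q" for x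
  proof -
    have "(\<integral>y. g x y * indicator (space (Yn Y n)) y \<partial>?O) = (\<integral>y. g x y \<partial>?O)"
      by (intro Bochner_Integration.integral_cong) auto
    then show ?thesis
      using split[OF x sets.top] measure_W_le_1[of x "space (Yn Y n)"] x supp by force
  qed
  \<comment> \<open>The weight \<open>real M\<close> on the tail masses balances the two terms: the
    potential is at most M^2 (\<theta>/M + p), and as both summands are nonnegative, it bounds the
    squared deviation and M^2 times the mean of \<open>H\<close> at once.\<close>
  obtain \<phi> where \<phi>: "\<And>i. \<phi> i \<in> set_pmf Q"
    and pot: "(\<integral>y. (\<Sum>i<M. g (\<phi> i) y - gbar y) * (\<Sum>i<M. g (\<phi> i) y - gbar y) \<partial>?O)
      + real M * (\<Sum>i<M. H (\<phi> i)) \<le> real M * (\<theta> + real M * p)"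
    using exists_small_deviation[OF O.prob_space_axioms supp gm g int gbar_def, of M "real M" H]
    unfolding p' by blast
  define S where "S y = (\<Sum>i<M. g (\<phi> i) y - gbar y)" for y
  have bS: "O.bounded_rv S"
    unfolding S_def by (intro O.bounded_rv_intros bg bgbar)
  have "0 \<le> (\<integral>y. S y * S y \<partial>?O)" by (intro integral_nonneg_AE) auto
  then have "real M * (\<Sum>i<M. H (\<phi> i)) \<le> real M * (\<theta> + real M * p)"
    using pot unfolding S_def by linarith
  then have "(\<Sum>i<M. H (\<phi> i)) \<le> \<theta> + real M * p"
    using M by (subst (asm) mult_le_cancel_left_pos) auto
  then have H: "(\<Sum>i<M. H (\<phi> i)) / real M \<le> \<theta> / real M + p"
    using M by (simp add: field_simps)
  have "0 \<le> real M * (\<Sum>i<M. H (\<phi> i))" by (intro mult_nonneg_nonneg sum_nonneg H0) auto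
  then have "(\<integral>y. S y * S y \<partial>?O) \<le> real M * (\<theta> + real M * p)"
    using pot unfolding S_def by linarith
  also have "\<dots> = (real M)\<^sup>2 * (\<theta> / real M + p)"
    using M by (simp add: field_simps power2_eq_square)
  finally have "sqrt (\<integral>y. S y * S y \<partial>?O) \<le> sqrt ((real M)\<^sup>2 * (\<theta> / real M + p))"
    by (rule real_sqrt_le_mono)
  then have sqrtS: "sqrt (\<integral>y. S y * S y \<partial>?O) \<le> real M * sqrt (\<theta> / real M + p)"
    by (simp add: real_sqrt_mult)
  define \<phi>' where "\<phi>' i = \<phi> (i - 1)" for i
  let ?U = "outdist Y W n (map_pmf \<phi>' (pmf_of_set {1..M}))"
  have dev: "\<bar>measure ?O B - measure ?U B\<bar> \<le> sqrt (\<theta> / real M + p) + \<theta> / real M + 2 * p"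
    if B: "B \<in> sets (Yn Y n)" for B
  proof -
    define a where "a x = (\<integral>y. g x y * indicator B y \<partial>?O)" for x
    obtain r where r: "\<And>x. x \<in> set_pmf Q \<Longrightarrow> 0 \<le> r x" "\<And>x. x \<in> set_pmf Q \<Longrightarrow> r x \<le> H x"
      "\<And>x. x \<in> set_pmf Q \<Longrightarrow> measure (W n x) B = a x + r x"
      unfolding a_def using split[OF _ B] by metis
    have "measure ?O B = (\<Sum>x\<in>inputs n. pmf Q x * (a x + r x))"
      unfolding measure_outdist[OF supp B]
    proof (intro sum.cong refl)
      fix x
      show "pmf Q x * measure (W n x) B = pmf Q x * (a x + r x)"
        using r(3)[of x] by (cases "x \<in> set_pmf Q") (auto simp: set_pmf_iff)
    qed
    then have O: "measure ?O B = (\<Sum>x\<in>inputs n. pmf Q x * a x) + (\<Sum>x\<in>inputs n. pmf Q x * r x)"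
      by (simp add: distrib_left sum.distrib)
    have "measure ?U B = (\<Sum>i\<in>{1..M}. measure (W n (\<phi> (i - 1))) B) / real M"
      using measure_outdist_uniform[of "{1..M}" \<phi>' B] M \<phi> supp B by (auto simp: \<phi>'_def image_subset_iff subset_iff)
    also have "(\<Sum>i\<in>{1..M}. measure (W n (\<phi> (i - 1))) B) = (\<Sum>i<M. measure (W n (\<phi> i)) B)"
      by (rule sum.reindex_bij_witness[of _ Suc "\<lambda>i. i - 1"]) auto
    finally have U: "measure ?U B = ((\<Sum>i<M. a (\<phi> i)) + (\<Sum>i<M. r (\<phi> i))) / real M"
      using r(3)[OF \<phi>] by (simp add: sum.distrib)
    have "(\<integral>y. S y * indicator B y \<partial>?O) =
        (\<Sum>i<M. (\<integral>y. g (\<phi> i) y * indicator B y - gbar y * indicator B y \<partial>?O))"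
      unfolding S_def sum_distrib_right left_diff_distrib
      using B by (intro Bochner_Integration.integral_sum O.bounded_rv_integrable O.bounded_rv_intros bg bgbar) simp_all
    also have "\<dots> = (\<Sum>i<M. a (\<phi> i) - (\<integral>y. gbar y * indicator B y \<partial>?O))"
      unfolding a_def
      using B by (intro sum.cong refl Bochner_Integration.integral_diff O.bounded_rv_integrable O.bounded_rv_intros bg bgbar) simp_all
    also have "(\<integral>y. gbar y * indicator B y \<partial>?O) = (\<Sum>x\<in>inputs n. pmf Q x * a x)"
    proof -
      have "(\<integral>y. gbar y * indicator B y \<partial>?O) = (\<integral>y. (\<Sum>x\<in>inputs n. pmf Q x * (g x y * indicator B y)) \<partial>?O)"
        unfolding gbar_def sum_distrib_right mult.assoc ..
      also have "\<dots> = (\<Sum>x\<in>inputs n. (\<integral>y. pmf Q x * (g x y * indicator B y) \<partial>?O))"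
        using B by (intro Bochner_Integration.integral_sum O.bounded_rv_integrable O.bounded_rv_intros bg) simp_all
      finally show ?thesis by (simp add: a_def)
    qed
    finally have SB: "(\<integral>y. S y * indicator B y \<partial>?O) =
        (\<Sum>i<M. a (\<phi> i)) - real M * (\<Sum>x\<in>inputs n. pmf Q x * a x)"
      by (simp add: sum_subtractf)
    have "measure ?U B - measure ?O B = (\<integral>y. S y * indicator B y \<partial>?O) / real M
        + (\<Sum>i<M. r (\<phi> i)) / real M - (\<Sum>x\<in>inputs n. pmf Q x * r x)"
      using M unfolding U O SB by (simp add: field_simps)
    moreover have "\<bar>(\<integral>y. S y * indicator B y \<partial>?O) / real M\<bar> \<le> sqrt (\<theta> / real M + p)"
    proof -
      have "\<bar>\<integral>y. S y * indicator B y \<partial>?O\<bar> \<le> real M * sqrt (\<theta> / real M + p)"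
        using O.abs_integral_indicator_le_sqrt[OF bS, of B] B sqrtS by simp
      then show ?thesis using M by (simp add: abs_divide field_simps)
    qed
    moreover have "0 \<le> (\<Sum>i<M. r (\<phi> i)) / real M"
      using r(1)[OF \<phi>] by (intro divide_nonneg_nonneg sum_nonneg) auto
    moreover have "(\<Sum>i<M. r (\<phi> i)) / real M \<le> \<theta> / real M + p"
    proof (rule order_trans[OF _ H])
      show "(\<Sum>i<M. r (\<phi> i)) / real M \<le> (\<Sum>i<M. H (\<phi> i)) / real M"
        using r(2)[OF \<phi>] by (intro divide_right_mono sum_mono) auto
    qed
    moreover have "0 \<le> (\<Sum>x\<in>inputs n. pmf Q x * r x) \<and> (\<Sum>x\<in>inputs n. pmf Q x * r x) \<le> p"
    proof -
      have "0 \<le> pmf Q x * r x \<and> pmf Q x * r x \<le> pmf Q x * H x" for x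
        using r(1,2)[of x] by (cases "x \<in> set_pmf Q") (auto simp: set_pmf_iff mult_left_mono)
      then show ?thesis unfolding p' by (intro conjI sum_nonneg sum_mono) auto
    qed
    moreover have "0 \<le> p" unfolding p' by (intro sum_nonneg mult_nonneg_nonneg H0) auto
    ultimately show ?thesis by linarith
  qed
  have "var_dist ?O ?U \<le> 2 * (sqrt (\<theta> / real M + p) + \<theta> / real M + 2 * p)"
    unfolding var_dist_def using dev by (intro mult_left_mono cSUP_least) (auto intro: sets.top)
  then show ?thesis using \<phi> by (intro exI[of _ \<phi>']) (auto simp: \<phi>'_def)
qed

lemma measure_info_dens_gt:
  "measure (jointdist Y W n Q) {z \<in> space (jointdist Y W n Q). \<beta> < info_dens Y W n Q z} =
    (\<Sum>x\<in>inputs n. pmf Q x * measure (W n x) {y \<in> space (Yn Y n). \<beta> < info_dens Y W n Q (x, y)})"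
proof -
  note [measurable] = info_dens_measurable[OF supp]
  let ?A = "{z \<in> space (jointdist Y W n Q). \<beta> < info_dens Y W n Q z}"
  have "info_dens Y W n Q \<in> borel_measurable (jointdist Y W n Q)" by measurable
  then have "?A \<in> sets (jointdist Y W n Q)"
    by (intro borel_measurable_less borel_measurable_const)
  then have "?A \<in> sets (count_space UNIV \<Otimes>\<^sub>M Yn Y n)" by (simp only: sets_jointdist)
  moreover have "Pair x -` ?A \<inter> space (Yn Y n) = {y \<in> space (Yn Y n). \<beta> < info_dens Y W n Q (x, y)}" for x
    by auto
  ultimately show ?thesis by (simp add: measure_jointdist[OF supp])
qed

text \<open>For \<open>\<beta> \<ge> 0\<close> the convention \<open>ln 0 = 0\<close> does no harm.\<close>
lemma info_dens_gt_iff: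
  assumes "1 \<le> n" "0 \<le> \<beta>"
  shows "\<beta> < info_dens Y W n Q (x, y) \<longleftrightarrow> exp (real n * \<beta>) < dens Q x y"
proof (cases "dens Q x y = 0")
  case True
  then show ?thesis using assms by (simp add: info_dens_eq[OF supp] not_less)
next
  case False
  then have pos: "0 < dens Q x y" using dens_nonneg[OF supp, of x y] by linarith
  have "\<beta> < info_dens Y W n Q (x, y) \<longleftrightarrow> real n * \<beta> < ln (dens Q x y)"
    using assms by (simp add: info_dens_eq[OF supp] field_simps)
  also have "\<dots> \<longleftrightarrow> exp (real n * \<beta>) < dens Q x y"
    using pos by (metis exp_ln exp_less_cancel_iff)
  finally show ?thesis .
qed

text \<open>This excludes negative spectral sup-information rates.\<close>
lemma measure_info_dens_gt_ge:
  assumes n: "1 \<le> n"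
  shows "1 - exp (real n * \<beta>) \<le>
    measure (jointdist Y W n Q) {z \<in> space (jointdist Y W n Q). \<beta> < info_dens Y W n Q z}"
proof -
  let ?a = "exp (real n * \<beta>)"
  note [measurable] = dens_measurable[OF supp] info_dens_measurable[OF supp]
  interpret O: prob_space "outdist Y W n Q" by (rule prob_space_outdist[OF supp])
  \<comment> \<open>Where the density is at most \<open>?a\<close>, the mass of \<open>W n x\<close>
    is at most \<open>?a\<close>, the output law being a probability. Elsewhere the density is
    positive and its logarithm genuine, so negative \<beta> are allowed.\<close>
  have *: "1 - ?a \<le> measure (W n x) {y \<in> space (Yn Y n). \<beta> < info_dens Y W n Q (x, y)}"
    if x: "x \<in> set_pmf Q" for x
  proof -
    have xi: "x \<in> inputs n" using x supp by auto
    let ?L = "{y \<in> space (Yn Y n). dens Q x y \<le> ?a}"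
    have "measure (W n x) (space (Yn Y n) \<inter> ?L) =
        (\<integral>y. (if dens Q x y \<le> ?a then dens Q x y else 0) * indicator (space (Yn Y n)) y \<partial>outdist Y W n Q)"
      by (rule measure_W_dens_le[OF x sets.top])
    also have "\<dots> \<le> (\<integral>y. ?a \<partial>outdist Y W n Q)"
      using dens_nonneg[OF supp]
      by (intro integral_mono O.integrable_const_bound[where B = ?a]) (auto simp: indicator_def)
    also have "\<dots> = ?a" using O.prob_space by simp
    finally have "measure (W n x) ?L \<le> ?a" by (simp add: Int_absorb1)
    then have "1 - ?a \<le> measure (W n x) (space (Yn Y n) - ?L)"
      using measure_W_compl[OF xi, of ?L] by simp
    also have "\<dots> \<le> measure (W n x) {y \<in> space (Yn Y n). \<beta> < info_dens Y W n Q (x, y)}"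
    proof (intro measure_W_mono xi subsetI)
      fix y assume y: "y \<in> space (Yn Y n) - ?L"
      then have gt: "?a < dens Q x y" by auto
      then have "0 < dens Q x y" using exp_gt_zero order_less_trans by blast
      then have "real n * \<beta> < ln (dens Q x y)"
        using gt by (metis exp_ln exp_less_cancel_iff)
      then show "y \<in> {y \<in> space (Yn Y n). \<beta> < info_dens Y W n Q (x, y)}"
        using n y by (simp add: info_dens_eq[OF supp] field_simps)
    qed measurable
    finally show ?thesis .
  qed
  have "1 - ?a = (\<Sum>x\<in>inputs n. pmf Q x * (1 - ?a))"
    using sum_pmf_inputs[OF supp] by (simp flip: sum_distrib_right)
  also have "\<dots> \<le> (\<Sum>x\<in>inputs n. pmf Q x * measure (W n x) {y \<in> space (Yn Y n). \<beta> < info_dens Y W n Q (x, y)})"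
  proof (rule sum_mono)
    fix x
    show "pmf Q x * (1 - ?a) \<le> pmf Q x * measure (W n x) {y \<in> space (Yn Y n). \<beta> < info_dens Y W n Q (x, y)}"
      using *[of x] by (cases "x \<in> set_pmf Q") (auto simp: set_pmf_iff mult_left_mono)
  qed
  finally show ?thesis by (simp only: measure_info_dens_gt)
qed

end
end

lemma resolv_achievable_for_if_I_upper_less:
  fixes W :: "nat \<Rightarrow> 'a::finite list \<Rightarrow> (nat \<Rightarrow> 'b) measure"
  assumes chan: "general_channel Y W" and \<delta>: "0 \<le> \<delta>" and PX: "PX \<in> S_Gamma c \<Gamma>"
    and R: "I_upper Y W PX < ereal R"
  shows "resolv_achievable_for Y W c \<Gamma> \<delta> R PX"
proof -
  define p where "p \<beta> n = measure (jointdist Y W n (PX n))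
    {z \<in> space (jointdist Y W n (PX n)). \<beta> < info_dens Y W n (PX n) z}" for \<beta> n
  obtain \<beta> where \<beta>: "p \<beta> \<longlonglongrightarrow> 0" "\<beta> < R"
    using R unfolding I_upper_def p_limsup_def Inf_less_iff p_def by auto
  have suppc: "set_pmf (PX n) \<subseteq> costset c \<Gamma> n" if "1 \<le> n" for n
    using PX that by (auto simp: S_Gamma_def)
  have supp: "set_pmf (PX n) \<subseteq> inputs n" if "1 \<le> n" for n
    using order_trans[OF suppc[OF that] costset_subset_inputs] .
  \<comment> \<open>For negative \<beta> the tail probabilities would tend to 1. The sign is needed
    for M n \<ge> 1 and for \<open>info_dens_gt_iff\<close>.\<close>
  have "0 \<le> \<beta>"
  proof (rule ccontr)
    assume "\<not> 0 \<le> \<beta>"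
    then have "(\<lambda>n. 1 - exp (real n * \<beta>)) \<longlonglongrightarrow> 1" by real_asymp
    moreover have "\<exists>N. \<forall>n\<ge>N. 1 - exp (real n * \<beta>) \<le> p \<beta> n"
      using finite_channel.measure_info_dens_gt_ge[OF finite_channel.intro[OF chan] supp, of _ \<beta>]
      by (intro exI[of _ 1]) (auto simp: p_def)
    ultimately have "1 \<le> (0 :: real)"
      using \<beta>(1) by (intro LIMSEQ_le)
    then show False by simp
  qed
  \<comment> \<open>Rounded down, since here the rate is bounded from above; the floor of a number
    that is at least 1 loses at most a factor 2. As \<beta> < R, \<theta> n / M n vanishes.\<close>
  define M where "M n = nat \<lfloor>exp (real n * R)\<rfloor>" for n
  define \<theta> where "\<theta> n = exp (real n * \<beta>)" for n
  have M1: "1 \<le> M n" for n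
    using \<beta>(2) \<open>0 \<le> \<beta>\<close> by (simp add: M_def le_nat_iff le_floor_iff)
  have Mle: "real (M n) \<le> exp (real n * R)" for n
    by (simp add: M_def)
  have Mge: "exp (real n * R) / 2 \<le> real (M n)" for n
    using M1[of n] unfolding M_def by linarith
  have "\<exists>\<phi>. (\<forall>i. \<phi> i \<in> set_pmf (PX n)) \<and>
    var_dist (outdist Y W n (PX n)) (outdist Y W n (map_pmf \<phi> (pmf_of_set {1..M n})))
      \<le> 2 * (sqrt (\<theta> n / real (M n) + p \<beta> n) + \<theta> n / real (M n) + 2 * p \<beta> n)" if n: "1 \<le> n" for n
  proof -
    interpret finite_channel Y W n by (rule finite_channel.intro[OF chan])
    show ?thesis
      by (rule soft_covering[OF supp[OF n] _ M1])
        (simp_all only: \<theta>_def p_def measure_info_dens_gt[OF supp[OF n]]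
          info_dens_gt_iff[OF supp[OF n] n \<open>0 \<le> \<beta>\<close>] exp_ge_zero)
  qed
  then obtain \<phi> where \<phi>: "\<And>n i. 1 \<le> n \<Longrightarrow> \<phi> n i \<in> set_pmf (PX n)"
    "\<And>n. 1 \<le> n \<Longrightarrow> var_dist (outdist Y W n (PX n)) (outdist Y W n (map_pmf (\<phi> n) (pmf_of_set {1..M n})))
      \<le> 2 * (sqrt (\<theta> n / real (M n) + p \<beta> n) + \<theta> n / real (M n) + 2 * p \<beta> n)"
    by metis
  have lim: "(\<lambda>n. \<theta> n / real (M n)) \<longlonglongrightarrow> 0"
  proof (rule tendsto_sandwich)
    show "\<forall>\<^sub>F n in sequentially. 0 \<le> \<theta> n / real (M n)" by (simp add: \<theta>_def)
    show "\<forall>\<^sub>F n in sequentially. \<theta> n / real (M n) \<le> 2 * exp (real n * (\<beta> - R))"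
    proof (rule always_eventually, rule allI)
      fix n
      have "\<theta> n / real (M n) \<le> \<theta> n / (exp (real n * R) / 2)"
        using Mge[of n] M1[of n] by (intro divide_left_mono) (auto simp: \<theta>_def)
      then show "\<theta> n / real (M n) \<le> 2 * exp (real n * (\<beta> - R))"
        by (simp add: \<theta>_def right_diff_distrib exp_diff field_simps)
    qed
    show "(\<lambda>n. 2 * exp (real n * (\<beta> - R))) \<longlonglongrightarrow> 0" using \<beta>(2) by real_asymp
  qed simp
  have "limsup (\<lambda>n. ereal (var_dist (outdist Y W n (PX n))
      (outdist Y W n (map_pmf (\<phi> n) (pmf_of_set {1..M n}))))) \<le> ereal 0"
  proof (rule limsup_le_lim)
    show "\<forall>\<^sub>F n in sequentially. var_dist (outdist Y W n (PX n)) (outdist Y W n (map_pmf (\<phi> n) (pmf_of_set {1..M n})))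
      \<le> 2 * (sqrt (\<theta> n / real (M n) + p \<beta> n) + \<theta> n / real (M n) + 2 * p \<beta> n)"
      using eventually_ge_at_top[of 1] by eventually_elim (rule \<phi>(2))
    have "(\<lambda>n. 2 * (sqrt (\<theta> n / real (M n) + p \<beta> n) + \<theta> n / real (M n) + 2 * p \<beta> n))
        \<longlonglongrightarrow> 2 * (sqrt (0 + 0) + 0 + 2 * 0)"
      by (intro tendsto_intros lim \<beta>(1))
    then show "(\<lambda>n. 2 * (sqrt (\<theta> n / real (M n) + p \<beta> n) + \<theta> n / real (M n) + 2 * p \<beta> n)) \<longlonglongrightarrow> 0"
      by simp
  qed
  then have d: "limsup (\<lambda>n. ereal (var_dist (outdist Y W n (PX n))
      (outdist Y W n (map_pmf (\<phi> n) (pmf_of_set {1..M n}))))) \<le> ereal \<delta>"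
    using \<delta> by (meson ereal_less_eq(3) order_trans)
  have rate: "limsup (\<lambda>n. ereal (ln (real (M n)) / real n)) \<le> ereal R"
  proof (rule limsup_le_lim)
    show "\<forall>\<^sub>F n in sequentially. ln (real (M n)) / real n \<le> R"
      using eventually_ge_at_top[of 1]
    proof eventually_elim
      case (elim n)
      have "ln (real (M n)) \<le> ln (exp (real n * R))"
        using Mle[of n] M1[of n] by (subst ln_le_cancel_iff) auto
      then show ?case using elim by (simp add: field_simps)
    qed
  qed simp
  show ?thesis
    unfolding resolv_achievable_for_def
  proof (intro exI conjI)
    show "\<forall>n\<ge>1. 1 \<le> M n \<and> (\<forall>i\<in>{1..M n}. \<phi> n i \<in> costset c \<Gamma> n)"
      using M1 \<phi>(1) suppc by blast
  qed (fact d rate)+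
qed

text \<open>Arguing with real R above the supremum also covers an empty \<open>S_Gamma\<close>: the
  supremum is then -\<infinity>, and every R is achievable vacuously.\<close>

lemma S_res_le_I_upper:
  fixes W :: "nat \<Rightarrow> 'a::finite list \<Rightarrow> (nat \<Rightarrow> 'b) measure"
  assumes "general_channel Y W" "0 \<le> \<delta>"
  shows "S_res Y W c \<Gamma> \<delta> \<le> (SUP PX\<in>S_Gamma c \<Gamma>. I_upper Y W PX)"
proof (rule le_ereal_if_all_greater)
  fix R assume R: "(SUP PX\<in>S_Gamma c \<Gamma>. I_upper Y W PX) < ereal R"
  have "resolv_achievable Y W c \<Gamma> \<delta> R"
    unfolding resolv_achievable_def
  proof
    fix PX assume PX: "PX \<in> S_Gamma c \<Gamma>"
    then have "I_upper Y W PX \<le> (SUP PX\<in>S_Gamma c \<Gamma>. I_upper Y W PX)" by (rule SUP_upper)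
    then have "I_upper Y W PX < ereal R" using R by (rule order_le_less_trans)
    then show "resolv_achievable_for Y W c \<Gamma> \<delta> R PX"
      by (rule resolv_achievable_for_if_I_upper_less[OF assms PX])
  qed
  then show "S_res Y W c \<Gamma> \<delta> \<le> ereal R"
    unfolding S_res_def by (intro Inf_lower) auto
qed

theorem theorem5p1:
  fixes Y :: "'b measure"
    and W :: "nat \<Rightarrow> 'a::finite list \<Rightarrow> (nat \<Rightarrow> 'b) measure"
    and c :: "nat \<Rightarrow> 'a list \<Rightarrow> real"
    and \<Gamma> \<epsilon> \<delta> \<mu> lam :: real
  assumes "general_channel Y W"
    and "0 \<le> \<epsilon>" and "0 \<le> \<delta>" and "0 \<le> \<mu>" and "0 \<le> lam"
    and "\<epsilon> \<le> \<mu>" and "\<epsilon> \<le> lam" and "\<delta> < 1 - \<mu> - lam"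
  shows "(SUP PX\<in>S_Gamma c \<Gamma>. I_lower Y W PX) \<le> C_s Y W c \<Gamma> \<epsilon>
       \<and> C_s Y W c \<Gamma> \<epsilon> \<le> D_id Y W c \<Gamma> \<mu> lam
       \<and> D_id Y W c \<Gamma> \<mu> lam \<le> S_res Y W c \<Gamma> \<delta>
       \<and> S_res Y W c \<Gamma> \<delta> \<le> (SUP PX\<in>S_Gamma c \<Gamma>. I_upper Y W PX)"
proof (intro conjI)
  show "(SUP PX\<in>S_Gamma c \<Gamma>. I_lower Y W PX) \<le> C_s Y W c \<Gamma> \<epsilon>"
    using assms by (intro SUP_least I_lower_le_C_s)
  show "C_s Y W c \<Gamma> \<epsilon> \<le> D_id Y W c \<Gamma> \<mu> lam"
    using assms by (intro C_s_le_D_id)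
  show "D_id Y W c \<Gamma> \<mu> lam \<le> S_res Y W c \<Gamma> \<delta>"
    using assms by (intro D_id_le_S_res)
  show "S_res Y W c \<Gamma> \<delta> \<le> (SUP PX\<in>S_Gamma c \<Gamma>. I_upper Y W PX)"
    using assms by (intro S_res_le_I_upper)
qed

end
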